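(* Let $\mathbb{K}$ be a field of characteristic $2$, let $\alpha \in \mathbb{K}\setminus\{0\}$, let $n \geq 1$ and let $A \in \mathrm{M}_n(\mathbb{K})$. Then $A$ is an $(\alpha,-\alpha)$-composite (in $\mathrm{M}_n(\mathbb{K})$) if and only if for every $\lambda \in \overline{\mathbb{K}} \setminus \{0,\alpha\}$, all blocks in the Jordan reduction of $A$ (over $\overline{\mathbb{K}}$) with respect to $\lambda$ have an even size.
   Context: $\overline{\mathbb{K}}$ is an algebraic closure of $\mathbb{K}$. For scalars $a,b \in \mathbb{K}\setminus\{0\}$, an element $x$ of a $\mathbb{K}$-algebra $\mathcal{A}$ is an $(a,b)$-composite if there are idempotents $p,q \in \mathcal{A}$ (i.e. $p^2=p$, $q^2=q$) with $x = a p + b q$. *)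

theory Defs
  imports
    "HOL-Algebra.Algebraic_Closure_Type"
    "Jordan_Normal_Form.Jordan_Normal_Form"
begin

definition composite_mat :: "nat \<Rightarrow> 'a :: field \<Rightarrow> 'a \<Rightarrow> 'a mat \<Rightarrow> bool" where
  "composite_mat n a b A \<longleftrightarrow>
     (\<exists>P \<in> carrier_mat n n. \<exists>Q \<in> carrier_mat n n.
        P * P = P \<and> Q * Q = Q \<and> A = a \<cdot>\<^sub>m P + b \<cdot>\<^sub>m Q)"

(* A Jordan reduction is unique only up to the order of its blocks, so occurrence of a block
   does not depend on the list chosen. Over a field where the characteristic polynomial does
   not split there is no Jordan reduction, and then no block occurs. *)
definition has_jordan_block :: "'a :: field mat \<Rightarrow> nat \<Rightarrow> 'a \<Rightarrow> bool" where
  "has_jordan_block A m \<mu> \<longleftrightarrow> (\<exists>n_as. jordan_nf A n_as \<and> (m, \<mu>) \<in> set n_as)"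

end

theory Submission
  imports
    Defs
    "Jordan_Normal_Form.Jordan_Normal_Form_Existence"
    "Jordan_Normal_Form.DL_Rank"
    "HOL-Library.Function_Algebras"
begin

text \<open>
  Put \<open>b = 1 / \<alpha>\<close>. In characteristic \<open>2\<close> a matrix \<open>A\<close> is an \<open>(\<alpha>, -\<alpha>)\<close>-composite iff
  there is an idempotent \<open>P\<close> with

    \<open>P A + A P = A + b A\<^sup>2\<close>,   (E)

  because then \<open>Q = P + b A\<close> is automatically idempotent and \<open>A = \<alpha> P - \<alpha> Q\<close>
  (\<open>composite_iff_idempotent_solution\<close>). The proof rests on the fact that the condition
  \<open>P\<^sup>2 = P\<close> can be dropped: if (E) has any solution \<open>P\<close>, it has an idempotent one
  (\<open>idempotent_solution\<close>). What remains is a linear system, and this settles everything else.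

  \<^item> Solvability of a linear system is insensitive to field extension, so (E) may be studied over
    the algebraic closure (\<open>commutator_solvable_descent\<close>, \<open>commutator_solvable_map\<close>). It is
    invariant under similarity, and a direct sum is solvable iff its summands are. Hence it
    suffices to treat one Jordan block of size \<open>m\<close> with eigenvalue \<open>\<mu>\<close>.

  \<^item> For such a block the left side of (E) has trace \<open>0\<close> and the right side has trace
    \<open>m (\<mu> + b \<mu>\<^sup>2)\<close>. So if \<open>m\<close> is odd, then \<open>\<mu> + b \<mu>\<^sup>2 = 0\<close>, that is, \<open>\<mu> = 0\<close> or \<open>\<mu> = \<alpha>\<close>. In
    all other cases there is an explicit tridiagonal solution.

  Why may \<open>P\<close> be taken idempotent? View the space as a \<open>K[t]\<close>-module on which \<open>t\<close> acts as \<open>A\<close>. A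
  solution \<open>P\<close> of (E) behaves like the derivation \<open>(t + b t\<^sup>2) d/dt\<close>, since
  \<open>P f(A) + f(A) P = f'(A) (A + b A\<^sup>2)\<close> for every polynomial \<open>f\<close> (\<open>commutator_act\<close>). If \<open>w\<close> generates
  a summand isomorphic to \<open>K[t]/(m)\<close>, where \<open>m\<close> kills the whole space, then taking \<open>f = m\<close> gives

    \<open>m\<close> divides \<open>m' (t + b t\<^sup>2)\<close>.

  On \<open>K[t]\<close> itself the map \<open>f \<mapsto> (1 + b t) f + (t + b t\<^sup>2) f'\<close> is an idempotent solution of (E), because
  it equals \<open>(1 + b t)\<close> times the projection onto the even part; and the divisibility is exactly
  what makes it descend to \<open>K[t]/(m)\<close>. It remains to split off cyclic summands one at a time, which
  works over any field (\<open>cyclic_summand\<close>).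
\<close>

section \<open>Coprimality and primes among polynomials over a field\<close>

lemma poly_bezout:
  fixes a b :: "'a :: field poly"
  shows "\<exists>r s. r * a + s * b dvd a \<and> r * a + s * b dvd b"
proof (induction "if b = 0 then 0 else Suc (degree b)" arbitrary: a b rule: less_induct)
  case less
  show ?case
  proof (cases "b = 0")
    case True
    then have "1 * a + 0 * b dvd a \<and> 1 * a + 0 * b dvd b"
      by simp
    then show ?thesis
      by blast
  next
    case False
    have "(if a mod b = 0 then 0 else Suc (degree (a mod b)))
        < (if b = 0 then 0 else Suc (degree b))"
      using False degree_mod_less[of b a] by auto
    from less[OF this] obtain r s
      where rs: "r * b + s * (a mod b) dvd b" "r * b + s * (a mod b) dvd a mod b"
      by blast
    have "r * b + s * (a mod b) dvd b * (a div b) + a mod b"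
      using rs by (intro dvd_add dvd_mult2)
    then have "r * b + s * (a mod b) dvd a"
      by simp
    moreover have "r * b + s * (a - b * q) = s * a + (r - s * q) * b" for q
      by (simp add: algebra_simps)
    then have "r * b + s * (a mod b) = s * a + (r - s * (a div b)) * b"
      by (metis minus_mult_div_eq_mod)
    ultimately show ?thesis
      using rs(1) by metis
  qed
qed

lemma ex_prime_poly_dvd:
  fixes g :: "'a :: field poly"
  assumes "degree g > 0"
  shows "\<exists>p. prime_elem p \<and> p dvd g"
  using assms
proof (induction "degree g" arbitrary: g rule: less_induct)
  case less
  show ?case
  proof (cases "irreducible g")
    case True
    then show ?thesis
      using field_poly_irreducible_imp_prime dvd_refl by (intro exI[of _ g] conjI)
  next
    case False
    have "g \<noteq> 0"
      using less.prems by auto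
    then have "\<not> g dvd 1"
      using less.prems is_unit_iff_degree[of g] by simp
    then obtain a b where ab: "g = a * b" "\<not> a dvd 1" "\<not> b dvd 1"
      using False \<open>g \<noteq> 0\<close> unfolding irreducible_def by blast
    then have "a \<noteq> 0" "b \<noteq> 0"
      using \<open>g \<noteq> 0\<close> by auto
    then have "degree a < degree g" "0 < degree a"
      using ab is_unit_iff_degree[of a] is_unit_iff_degree[of b] by (auto simp: degree_mult_eq)
    from less.hyps[OF this] obtain p where "prime_elem p" "p dvd a"
      by blast
    then show ?thesis
      using ab(1) by (intro exI[of _ p] conjI) simp_all
  qed
qed

text \<open>
  The dichotomy behind the construction of a separating vector below: sums of vectors serve in the
  first case, and in the second a common prime can be cancelled.
\<close>

lemma bezout_or_common_prime:
  fixes a b :: "'a :: field poly"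
  assumes "a \<noteq> 0"
  obtains r s where "r * a + s * b = 1" | p where "prime_elem p" "p dvd a" "p dvd b"
proof -
  obtain r s where rs: "r * a + s * b dvd a" "r * a + s * b dvd b"
    using poly_bezout by blast
  show ?thesis
  proof (cases "degree (r * a + s * b) > 0")
    case True
    then show ?thesis
      using ex_prime_poly_dvd rs that(2) dvd_trans by metis
  next
    case False
    moreover have "r * a + s * b \<noteq> 0"
      using rs(1) assms by auto
    ultimately have "r * a + s * b dvd 1"
      by (simp add: is_unit_iff_degree)
    then obtain k where "1 = (r * a + s * b) * k" ..
    then have "(k * r) * a + (k * s) * b = 1"
      by (simp add: algebra_simps)
    then show ?thesis
      using that(1) by blast
  qed
qed

lemma split_off_prime_power:
  fixes a p :: "'a :: field poly"
  assumes "a \<noteq> 0" "prime_elem p"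
  obtains i c where "a = p ^ i * c" "\<not> p dvd c"
proof -
  have "\<exists>i c. a = p ^ i * c \<and> \<not> p dvd c"
    using assms(1)
  proof (induction "degree a" arbitrary: a rule: less_induct)
    case less
    show ?case
    proof (cases "p dvd a")
      case False
      then show ?thesis
        by (intro exI[of _ 0] exI[of _ a]) simp
    next
      case True
      then obtain k where k: "a = p * k" ..
      have "degree p > 0"
        using assms(2) is_unit_iff_degree[of p] unfolding prime_elem_def by blast
      then have "degree k < degree a" "k \<noteq> 0"
        using k less.prems by (auto simp: degree_mult_eq)
      from less.hyps[OF this] obtain i c where "k = p ^ i * c" "\<not> p dvd c"
        by blast
      then show ?thesis
        using k by (intro exI[of _ "Suc i"] exI[of _ c]) (simp add: mult.assoc)
    qed
  qed
  then show ?thesis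
    using that by blast
qed

lemma prime_power_mult_dvd:
  fixes p c f :: "'a :: idom"
  assumes "prime_elem p" "\<not> p dvd c" "p ^ j dvd f" "c dvd f"
  shows "p ^ j * c dvd f"
  using assms(3)
proof (induction j)
  case 0
  then show ?case
    using assms(4) by simp
next
  case (Suc j)
  have "p ^ j dvd p ^ Suc j"
    by simp
  with Suc obtain k where k: "f = p ^ j * c * k"
    using dvd_trans by (metis dvdE)
  have "p \<noteq> 0"
    using assms(1) by (simp add: prime_elem_def)
  with Suc.prems k have "p dvd c * k"
    by (simp add: mult.assoc power_Suc2 del: power_Suc)
  then have "p dvd k"
    using assms(1,2) prime_elem_dvd_multD by blast
  then show ?case
    using k by (auto simp: mult_ac)
qed

section \<open>Characteristic two\<close>

lemma char_2_double:
  fixes x :: "'a :: comm_ring_1"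
  assumes "CHAR('a) = 2"
  shows "x + x = 0"
proof -
  have "(2 :: 'a) = 0"
    using of_nat_CHAR[where 'a = 'a] assms by simp
  then show ?thesis
    by (metis mult_2 mult_zero_left)
qed

lemma char_2_poly_double:
  fixes f :: "'a :: field poly"
  assumes "CHAR('a) = 2"
  shows "f + f = 0"
  using assms by (intro poly_eqI) (simp add: char_2_double)

text \<open>
  The second derivative of \<open>t\<^sup>i\<close> has the even coefficient \<open>i (i - 1)\<close>.
\<close>

lemma char_2_pderiv_pderiv:
  fixes f :: "'a :: field poly"
  assumes "CHAR('a) = 2"
  shows "pderiv (pderiv f) = 0"
proof (intro poly_eqI)
  fix i
  have "(of_nat (Suc i * Suc (Suc i)) :: 'a) = 0"
    unfolding of_nat_eq_0_iff_char_dvd assms by simp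
  then have "(of_nat (Suc i) :: 'a) * of_nat (Suc (Suc i)) = 0"
    by (simp only: of_nat_mult)
  then show "coeff (pderiv (pderiv f)) i = coeff 0 i"
    by (simp only: coeff_pderiv mult.assoc[symmetric] mult_zero_left coeff_0)
qed

section \<open>The polynomial action of a linear operator\<close>

locale linear_operator = vector_space scale
  for scale :: "'a :: field \<Rightarrow> 'b :: ab_group_add \<Rightarrow> 'b" (infixr "*s" 75) +
  fixes T :: "'b \<Rightarrow> 'b"
  assumes T_add: "T (u + v) = T u + T v"
    and T_scale: "T (c *s v) = c *s T v"
begin

lemma T_zero [simp]: "T 0 = 0"
  using T_add[of 0 0] by simp

text \<open>
  This is \<open>f(T) v\<close>, computed by the Horner scheme.
\<close>

definition act :: "'a poly \<Rightarrow> 'b \<Rightarrow> 'b" where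
  "act f v = fold_coeffs (\<lambda>a w. a *s v + T w) f 0"

lemma act_0 [simp]: "act 0 v = 0"
  by (simp add: act_def)

lemma act_pCons [simp]: "act (pCons a f) v = a *s v + T (act f v)"
  by (cases "f = 0 \<and> a = 0") (auto simp: act_def)

lemma act_add: "act (f + g) v = act f v + act g v"
  by (induction f g rule: poly_induct2) (simp_all add: T_add scale_left_distrib algebra_simps)

lemma act_smult: "act (smult c f) v = c *s act f v"
  by (induction f) (simp_all add: T_scale scale_right_distrib)

lemma act_mult: "act (f * g) v = act f (act g v)"
  by (induction f) (simp_all add: act_add act_smult)

lemma act_commute: "act f (act g v) = act g (act f v)"
  by (metis act_mult mult.commute)

lemma act_1 [simp]: "act 1 v = v"
  by (simp add: one_pCons)

lemma act_T: "act f (T v) = T (act f v)"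
  using act_commute[of f "[:0, 1:]" v] by simp

lemma act_add_right: "act f (u + v) = act f u + act f v"
  by (induction f) (simp_all add: T_add scale_right_distrib algebra_simps)

lemma act_scale_right: "act f (c *s v) = c *s act f v"
  by (induction f) (simp_all add: T_scale scale_right_distrib mult.commute)

lemma act_zero_right [simp]: "act f 0 = 0"
  using act_add_right[of f 0 0] by simp

lemma act_diff: "act (f - g) v = act f v - act g v"
  using act_add[of "f - g" g v] by (simp add: algebra_simps)

lemma act_diff_right: "act f (u - v) = act f u - act f v"
  using act_add_right[of f "u - v" v] by (simp add: algebra_simps)

lemma act_sum: "act (sum f I) v = (\<Sum>i\<in>I. act (f i) v)"
  by (induction I rule: infinite_finite_induct) (simp_all add: act_add)

lemma act_as_sum:
  assumes "degree f < k"
  shows "act f v = (\<Sum>i<k. coeff f i *s act (monom 1 i) v)"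
proof -
  have "f = (\<Sum>i<k. monom (coeff f i) i)"
    using assms by (intro poly_eqI) (auto simp: coeff_sum coeff_eq_0 not_less)
  then have "act f v = (\<Sum>i<k. act (monom (coeff f i) i) v)"
    by (metis act_sum)
  also have "\<dots> = (\<Sum>i<k. coeff f i *s act (monom 1 i) v)"
    by (intro sum.cong refl) (metis act_smult mult.right_neutral smult_monom)
  finally show ?thesis .
qed

text \<open>
  The polynomials killing a vector form an ideal; \<open>m\<close> is a nonzero generator of it.
\<close>

definition ann_generator :: "'b \<Rightarrow> 'a poly \<Rightarrow> bool" where
  "ann_generator v m \<longleftrightarrow> m \<noteq> 0 \<and> (\<forall>f. act f v = 0 \<longleftrightarrow> m dvd f)"

lemma ex_ann_generator:
  assumes "act f v = 0" "f \<noteq> 0"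
  shows "\<exists>m. ann_generator v m"
proof -
  define m where "m = arg_min degree (\<lambda>f. act f v = 0 \<and> f \<noteq> 0)"
  have m: "act m v = 0" "m \<noteq> 0"
    using arg_min_natI[of "\<lambda>f. act f v = 0 \<and> f \<noteq> 0" f degree] assms
    unfolding m_def by auto
  have min: "degree m \<le> degree g" if "act g v = 0" "g \<noteq> 0" for g
    using arg_min_nat_le[of "\<lambda>f. act f v = 0 \<and> f \<noteq> 0" g degree] that
    unfolding m_def by auto
  have "act g v = 0 \<longleftrightarrow> m dvd g" for g
  proof
    assume "m dvd g"
    then show "act g v = 0"
      using m by (auto simp: act_mult act_commute)
  next
    assume g: "act g v = 0"
    have "act (g mod m) v = act (g - (g div m) * m) v"
      by (simp add: minus_div_mult_eq_mod)
    then have "act (g mod m) v = 0"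
      using g m by (simp add: act_diff act_mult)
    then have "g mod m = 0"
      using min[of "g mod m"] degree_mod_less[of m g] m(2) by fastforce
    then show "m dvd g"
      by auto
  qed
  then show ?thesis
    using m unfolding ann_generator_def by blast
qed

text \<open>
  Used in both directions: in a finite-dimensional space some nonzero polynomial must kill \<open>v\<close>, and
  below the degree of the generator of its annihilator the vectors \<open>T\<^sup>i v\<close> are independent.
\<close>

lemma powers_independent:
  assumes "\<And>f. degree f < k \<Longrightarrow> act f v = 0 \<Longrightarrow> f = 0"
  shows "inj_on (\<lambda>i. act (monom 1 i) v) {..<k}"
    and "independent ((\<lambda>i. act (monom 1 i) v) ` {..<k})"
proof -
  show inj: "inj_on (\<lambda>i. act (monom 1 i) v) {..<k}"
  proof (rule inj_onI)
    fix i j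
    assume ij: "i \<in> {..<k}" "j \<in> {..<k}" "act (monom 1 i) v = act (monom 1 j) v"
    have "degree (monom 1 i - monom (1::'a) j) < k"
      using ij(1,2) by (intro degree_diff_less) (simp_all add: degree_monom_eq)
    then have "monom 1 i = monom (1::'a) j"
      using assms[of "monom 1 i - monom 1 j"] ij(3) by (simp add: act_diff)
    then show "i = j"
      by (metis degree_monom_eq one_neq_zero)
  qed
  show "independent ((\<lambda>i. act (monom 1 i) v) ` {..<k})"
  proof (rule independent_if_scalars_zero)
    fix c :: "'b \<Rightarrow> 'a" and x
    let ?p = "\<lambda>i. act (monom 1 i) v"
    let ?f = "\<Sum>i<k. monom (c (?p i)) i"
    assume sum0: "(\<Sum>x\<in>?p ` {..<k}. c x *s x) = 0" and x: "x \<in> ?p ` {..<k}"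
    have cf: "coeff ?f i = (if i < k then c (?p i) else 0)" for i
      by (simp add: coeff_sum)
    from x have "k > 0"
      by auto
    then have deg: "degree ?f < k"
      using cf by (intro degree_lessI) auto
    have "act ?f v = (\<Sum>x\<in>?p ` {..<k}. c x *s x)"
      using inj by (subst act_as_sum[OF deg]) (simp add: cf sum.reindex)
    then have "?f = 0"
      using assms[OF deg] sum0 by simp
    moreover obtain i where i: "i < k" "x = ?p i"
      using x by blast
    ultimately have "coeff ?f i = 0"
      by simp
    then show "c x = 0"
      using cf[of i] i by simp
  qed simp
qed

end

section \<open>Splitting off a cyclic summand\<close>

lemma (in vector_space) ex_functional_extending:
  fixes g :: "'b \<Rightarrow> 'a"
  assumes "independent B"
  obtains \<phi> where "\<And>u v. \<phi> (u + v) = \<phi> u + \<phi> v" "\<And>c v. \<phi> (c *s v) = c * \<phi> v"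
    "\<And>v. v \<in> B \<Longrightarrow> \<phi> v = g v"
proof -
  interpret functionals: vector_space_pair scale "(*) :: 'a \<Rightarrow> 'a \<Rightarrow> 'a"
    by unfold_locales (simp_all add: algebra_simps)
  obtain \<phi> where \<phi>: "Vector_Spaces.linear scale (*) \<phi>" "\<forall>v\<in>B. \<phi> v = g v"
    using functionals.linear_independent_extend[OF assms, of g] by blast
  show thesis
    by (rule that[of \<phi>]) (use \<phi> in \<open>simp_all add: Vector_Spaces.linear_iff\<close>)
qed

context linear_operator
begin

text \<open>
  Linearity is required on \<open>V\<close> only, since the maps constructed below come from a decomposition
  of \<open>V\<close> and have arbitrary values elsewhere.
\<close>

definition lin_on :: "'b set \<Rightarrow> ('b \<Rightarrow> 'b) \<Rightarrow> bool" where
  "lin_on V g \<longleftrightarrow> (\<forall>v\<in>V. g v \<in> V) \<and> (\<forall>v\<in>V. \<forall>w\<in>V. g (v + w) = g v + g w)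
     \<and> (\<forall>c. \<forall>v\<in>V. g (c *s v) = c *s g v)"

definition invariant_subspace :: "'b set \<Rightarrow> bool" where
  "invariant_subspace V \<longleftrightarrow> subspace V \<and> (\<forall>v\<in>V. T v \<in> V)"

text \<open>
  Phrased through independent sets so that the bound passes to every subspace of \<open>V\<close>.
\<close>

definition dim_at_most :: "nat \<Rightarrow> 'b set \<Rightarrow> bool" where
  "dim_at_most n V \<longleftrightarrow> (\<forall>B. B \<subseteq> V \<longrightarrow> independent B \<longrightarrow> finite B \<and> card B \<le> n)"

lemma dim_at_mostD:
  assumes "dim_at_most n V" "independent B" "B \<subseteq> V"
  shows "finite B" "card B \<le> n"
  using assms by (simp_all add: dim_at_most_def)

lemma act_in_invariant:
  assumes "invariant_subspace V" "v \<in> V"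
  shows "act f v \<in> V"
  using assms
  by (induction f)
     (auto simp: invariant_subspace_def intro: subspace_0 subspace_add subspace_scale)

lemma ex_ann_generator_in:
  assumes "invariant_subspace V" "dim_at_most n V" "v \<in> V"
  shows "\<exists>m. ann_generator v m"
proof -
  have "\<exists>f. degree f < Suc n \<and> act f v = 0 \<and> f \<noteq> 0"
  proof (rule ccontr)
    assume "\<nexists>f. degree f < Suc n \<and> act f v = 0 \<and> f \<noteq> 0"
    then have *: "\<And>f. degree f < Suc n \<Longrightarrow> act f v = 0 \<Longrightarrow> f = 0"
      by blast
    let ?B = "(\<lambda>i. act (monom 1 i) v) ` {..<Suc n}"
    have "card ?B = Suc n"
      using powers_independent(1)[OF *] by (subst card_image) auto
    moreover have "?B \<subseteq> V"
      using act_in_invariant assms by blast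
    moreover have "independent ?B"
      using powers_independent(2)[OF *] by blast
    ultimately show False
      using assms(2)[unfolded dim_at_most_def, rule_format, of ?B] by simp
  qed
  then show ?thesis
    using ex_ann_generator by blast
qed

text \<open>
  Let \<open>a\<close> and \<open>b\<close> generate the annihilators of \<open>u\<close> and \<open>v\<close>. If they are coprime, then \<open>w = u + v\<close>
  works: \<open>f w = 0\<close> gives \<open>a f v = a f w - f a u = 0\<close> as well as \<open>b f v = 0\<close>, hence \<open>f v = 0\<close>.
  Otherwise let \<open>p\<close> be a common prime and compare its exponents \<open>i\<close> in \<open>a\<close> and \<open>j\<close> in \<open>b\<close>. If
  \<open>j \<le> i\<close>, replace \<open>v\<close> by \<open>p\<^sup>j v\<close>, whose annihilator is generated by the part of \<open>b\<close> prime to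
  \<open>p\<close>. The factor \<open>p\<^sup>j\<close> that is lost for \<open>v\<close> is recovered at the end from \<open>u\<close>, because every \<open>f\<close>
  killing \<open>u\<close> is a multiple of \<open>p\<^sup>i\<close>. The case \<open>i < j\<close> is symmetric.
\<close>

lemma ex_vector_separating_two:
  assumes "invariant_subspace V" "u \<in> V" "v \<in> V" "ann_generator u a" "ann_generator v b"
  shows "\<exists>w\<in>V. \<forall>f. act f w = 0 \<longrightarrow> act f u = 0 \<and> act f v = 0"
  using assms(2-)
proof (induction "degree a + degree b" arbitrary: u v a b rule: less_induct)
  case less
  have nz: "a \<noteq> 0" "b \<noteq> 0"
    and a: "\<And>f. act f u = 0 \<longleftrightarrow> a dvd f" and b: "\<And>f. act f v = 0 \<longleftrightarrow> b dvd f"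
    using less.prems by (auto simp: ann_generator_def)
  from nz(1) show ?case
  proof (cases rule: bezout_or_common_prime[of a b])
    case (1 r s)
    show ?thesis
    proof (intro bexI[of _ "u + v"] allI impI)
      show "u + v \<in> V"
        using less.prems assms(1) by (auto simp: invariant_subspace_def intro: subspace_add)
      fix f
      assume "act f (u + v) = 0"
      then have sum0: "act f u + act f v = 0"
        by (simp add: act_add_right)
      have "act a (act f u) = 0"
        using a by (simp flip: act_mult)
      moreover have "act a (act f u + act f v) = 0"
        by (simp add: sum0)
      ultimately have "act a (act f v) = 0"
        by (simp add: act_add_right)
      moreover have "act b (act f v) = 0"
        using b by (simp flip: act_mult)
      moreover have "act f v = act (r * a + s * b) (act f v)"
        by (simp add: 1)
      ultimately have "act f v = 0"
        by (simp add: act_add act_mult)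
      with sum0 show "act f u = 0 \<and> act f v = 0"
        by simp
    qed
  next
    case (2 p)
    obtain i a' where a': "a = p ^ i * a'" "\<not> p dvd a'"
      using split_off_prime_power[OF nz(1) 2(1)] .
    obtain j b' where b': "b = p ^ j * b'" "\<not> p dvd b'"
      using split_off_prime_power[OF nz(2) 2(1)] .
    have p0: "p \<noteq> 0" and degp: "degree p > 0"
      using 2(1) is_unit_iff_degree[of p] unfolding prime_elem_def by blast+
    have "i \<noteq> 0" "j \<noteq> 0"
      using a' b' 2(2,3) by (auto intro!: Nat.gr0I)
    have divided: "ann_generator (act (p ^ k) x) c"
      if "ann_generator x (p ^ k * c)" for x k c
      using that p0 by (auto simp: ann_generator_def mult.commute simp flip: act_mult)
    have deg: "degree c < degree (p ^ k * c)" if "k \<noteq> 0" "p ^ k * c \<noteq> 0" for k c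
      using that degp by (simp add: degree_mult_eq degree_power_eq)
    have pow: "p ^ k dvd p ^ l * c" if "k \<le> l" for k l c
      using that by (simp add: le_imp_power_dvd dvd_mult2)
    show ?thesis
    proof (cases "j \<le> i")
      case True
      have "act (p ^ j) v \<in> V" "ann_generator (act (p ^ j) v) b'" "degree b' < degree b"
        using less.prems assms(1) act_in_invariant divided b' deg \<open>j \<noteq> 0\<close> nz by auto
      then obtain w where w: "w \<in> V"
        "\<And>f. act f w = 0 \<Longrightarrow> act f u = 0 \<and> act f (act (p ^ j) v) = 0"
        using less.hyps[of a b' u "act (p ^ j) v"] less.prems by auto
      have "act f v = 0" if "act f w = 0" for f
      proof -
        have "a dvd f"
          using w(2) that a by blast
        then have "p ^ j dvd f"
          using pow[OF True] a'(1) dvd_trans by blast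
        moreover have "b' dvd f"
          using w(2) that \<open>ann_generator (act (p ^ j) v) b'\<close> by (auto simp: ann_generator_def)
        ultimately have "b dvd f"
          using prime_power_mult_dvd 2(1) b' by blast
        then show ?thesis
          using b by blast
      qed
      then show ?thesis
        using w by blast
    next
      case False
      then have "i \<le> j"
        by simp
      have "act (p ^ i) u \<in> V" "ann_generator (act (p ^ i) u) a'" "degree a' < degree a"
        using less.prems assms(1) act_in_invariant divided a' deg \<open>i \<noteq> 0\<close> nz by auto
      then obtain w where w: "w \<in> V"
        "\<And>f. act f w = 0 \<Longrightarrow> act f (act (p ^ i) u) = 0 \<and> act f v = 0"
        using less.hyps[of a' b "act (p ^ i) u" v] less.prems by auto
      have "act f u = 0" if "act f w = 0" for f
      proof -
        have "b dvd f"
          using w(2) that b by blast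
        then have "p ^ i dvd f"
          using pow[OF \<open>i \<le> j\<close>] b'(1) dvd_trans by blast
        moreover have "a' dvd f"
          using w(2) that \<open>ann_generator (act (p ^ i) u) a'\<close> by (auto simp: ann_generator_def)
        ultimately have "a dvd f"
          using prime_power_mult_dvd 2(1) a' by blast
        then show ?thesis
          using a by blast
      qed
      then show ?thesis
        using w by blast
    qed
  qed
qed

text \<open>
  Apply the previous lemma along a basis of \<open>V\<close>: there is a vector whose annihilator is generated by
  the minimal polynomial of \<open>T\<close> on \<open>V\<close>.
\<close>

lemma ex_separating_vector:
  assumes V: "invariant_subspace V" and fin: "dim_at_most n V"
  shows "\<exists>w\<in>V. \<forall>f. act f w = 0 \<longrightarrow> (\<forall>v\<in>V. act f v = 0)"
proof -
  have sub: "subspace V"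
    using V by (simp add: invariant_subspace_def)
  obtain B where B: "B \<subseteq> V" "independent B" "V \<subseteq> span B"
    using maximal_independent_subset .
  have "finite B"
    using fin B by (auto simp: dim_at_most_def)
  then have "B \<subseteq> V \<Longrightarrow> \<exists>w\<in>V. \<forall>f. act f w = 0 \<longrightarrow> (\<forall>v\<in>B. act f v = 0)"
  proof (induction B rule: finite_induct)
    case empty
    then show ?case
      using subspace_0[OF sub] by auto
  next
    case (insert v B)
    then have "B \<subseteq> V" "v \<in> V"
      by auto
    from insert.IH[OF this(1)] obtain w
      where w: "w \<in> V" "\<forall>f. act f w = 0 \<longrightarrow> (\<forall>v\<in>B. act f v = 0)"
      by (rule bexE)
    obtain a b where "ann_generator w a" "ann_generator v b"
      using ex_ann_generator_in[OF V fin] w(1) \<open>v \<in> V\<close> by metis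
    from ex_vector_separating_two[OF V w(1) \<open>v \<in> V\<close> this] obtain w'
      where w': "w' \<in> V" "\<forall>f. act f w' = 0 \<longrightarrow> act f w = 0 \<and> act f v = 0"
      by (rule bexE)
    show ?case
    proof (intro bexI[OF _ w'(1)] allI impI ballI)
      fix f x
      assume f: "act f w' = 0" and x: "x \<in> insert v B"
      have fw: "act f w = 0" and fv: "act f v = 0"
        using w'(2)[rule_format, OF f] by (rule conjunct1, rule conjunct2)
      show "act f x = 0"
        using x fv w(2)[rule_format, OF fw] by (elim insertE) (simp_all only:)
    qed
  qed
  from this[OF B(1)] obtain w
    where w: "w \<in> V" "\<forall>f. act f w = 0 \<longrightarrow> (\<forall>v\<in>B. act f v = 0)"
    by (rule bexE)
  show ?thesis
  proof (intro bexI[OF _ w(1)] allI impI ballI)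
    fix f v
    assume f: "act f w = 0" and "v \<in> V"
    then have "v \<in> span B"
      using B(3) by blast
    then show "act f v = 0"
    proof (induction rule: span_induct_alt)
      case base
      then show ?case
        by simp
    next
      case (step c x y)
      then show ?case
        using w(2)[rule_format, OF f step(1)] by (simp add: act_add_right act_scale_right)
    qed
  qed
qed

text \<open>
  Take a vector \<open>w\<close> whose annihilator is generated by a polynomial \<open>m\<close> killing \<open>V\<close>, put
  \<open>d = deg m\<close>, and choose a functional \<open>\<phi>\<close> that is \<open>1\<close> on \<open>T\<^bsup>d-1\<^esup> w\<close> and \<open>0\<close> on the lower powers. The
  complement is the largest invariant subspace of \<open>V\<close> in the kernel of \<open>\<phi>\<close>. It meets the cyclic
  subspace trivially because a nonzero \<open>f w\<close> with \<open>deg f < d\<close> can be shifted so that its leading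
  coefficient is seen by \<open>\<phi>\<close>, and the two span \<open>V\<close> because the matrix \<open>\<phi> (T\<^bsup>i+j\<^esup> w)\<close> with
  \<open>i, j < d\<close> is anti-triangular.
\<close>

lemma cyclic_summand:
  assumes V: "invariant_subspace V" and fin: "dim_at_most n V" and nontriv: "V \<noteq> {0}"
  obtains w m W where
    "w \<in> V" "w \<noteq> 0" "ann_generator w m" "\<And>v. v \<in> V \<Longrightarrow> act m v = 0" "invariant_subspace W" "W \<subseteq> V"
    "\<And>v. v \<in> V \<Longrightarrow> \<exists>f. \<exists>z\<in>W. v = act f w + z"
    "\<And>f. act f w \<in> W \<Longrightarrow> act f w = 0"
proof -
  have sub: "subspace V"
    using V by (simp add: invariant_subspace_def)
  from ex_separating_vector[OF V fin] obtain w
    where w: "w \<in> V" "\<forall>f. act f w = 0 \<longrightarrow> (\<forall>v\<in>V. act f v = 0)"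
    by (rule bexE)
  obtain m where m: "ann_generator w m"
    using ex_ann_generator_in[OF V fin w(1)] by blast
  then have m0: "m \<noteq> 0" and mw: "\<And>f. act f w = 0 \<longleftrightarrow> m dvd f"
    by (auto simp: ann_generator_def)
  have kill: "act m v = 0" if "v \<in> V" for v
    using w(2)[rule_format, of m v] mw[of m] that by simp
  have w0: "w \<noteq> 0"
  proof
    assume "w = 0"
    then have "act 1 v = 0" if "v \<in> V" for v
      using w(2)[rule_format, of 1 v] that \<open>w = 0\<close> by simp
    then show False
      using nontriv subspace_0[OF sub] by auto
  qed
  define d where "d = degree m"
  have d0: "d > 0"
  proof (rule ccontr)
    assume "\<not> d > 0"
    then have "m dvd 1"
      using m0 by (simp add: d_def is_unit_iff_degree)
    then show False
      using mw[of 1] w0 by simp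
  qed
  have mod_deg: "degree (f mod m) < d" for f
    unfolding d_def using degree_mod_less[OF m0, of f] d0 by (auto simp: d_def)
  have act_mod: "act (f mod m) v = act f v" if "v \<in> V" for f v
  proof -
    have "act f v = act (f div m * m + f mod m) v"
      by simp
    also have "\<dots> = act (f mod m) v"
      by (simp only: act_add act_mult kill[OF that] act_zero_right add_0_left)
    finally show ?thesis ..
  qed
  have small: "f = 0" if "degree f < d" "act f w = 0" for f
  proof (rule ccontr)
    assume "f \<noteq> 0"
    then show False
      using that mw[of f] dvd_imp_degree_le[of m f] by (simp add: d_def)
  qed
  let ?p = "\<lambda>i. act (monom 1 i) w"
  have inj: "inj_on ?p {..<d}" and indep: "independent (?p ` {..<d})"
    using powers_independent[of d w] small by blast+
  obtain \<phi> where \<phi>_add: "\<And>u v. \<phi> (u + v) = \<phi> u + \<phi> v" and \<phi>_scale: "\<And>c v. \<phi> (c *s v) = c * \<phi> v"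
    and \<phi>_basis: "\<And>v. v \<in> ?p ` {..<d} \<Longrightarrow> \<phi> v = (if v = ?p (d - 1) then 1 else 0)"
    by (rule ex_functional_extending[OF indep,
        where g = "\<lambda>v. if v = ?p (d - 1) then 1 else 0"]) blast
  have \<phi>_0: "\<phi> 0 = 0"
    using \<phi>_scale[of 0 0] by simp
  have \<phi>_diff: "\<phi> (u - v) = \<phi> u - \<phi> v" for u v
    using \<phi>_add[of "u - v" v] by simp
  have \<phi>_sum: "\<phi> (sum h I) = (\<Sum>i\<in>I. \<phi> (h i))" for h and I :: "nat set"
    by (induction I rule: infinite_finite_induct) (simp_all add: \<phi>_0 \<phi>_add)
  have \<phi>_pow: "\<phi> (?p i) = (if i = d - 1 then 1 else 0)" if "i < d" for i
    using \<phi>_basis that d0 inj_onD[OF inj, of i "d - 1"] by auto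
  have \<phi>_act: "\<phi> (act f w) = coeff f (d - 1)" if "degree f < d" for f
  proof -
    have "\<phi> (act f w) = (\<Sum>i<d. coeff f i * \<phi> (?p i))"
      by (subst act_as_sum[OF that]) (simp add: \<phi>_sum \<phi>_scale)
    also have "\<dots> = (\<Sum>i<d. if i = d - 1 then coeff f i else 0)"
      by (intro sum.cong) (auto simp: \<phi>_pow)
    also have "\<dots> = coeff f (d - 1)"
      using d0 by simp
    finally show ?thesis .
  qed
  define W where "W = {v \<in> V. \<forall>f. \<phi> (act f v) = 0}"
  show thesis
  proof (rule that[OF w(1) w0 m kill])
    show "W \<subseteq> V"
      by (auto simp: W_def)
    have "subspace W"
      using sub unfolding W_def subspace_def
      by (auto simp: act_add_right act_scale_right \<phi>_add \<phi>_scale \<phi>_0)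
    moreover have "T v \<in> W" if v: "v \<in> W" for v
    proof -
      have "\<phi> (act (pCons 0 f) v) = 0" for f
        using v unfolding W_def by blast
      then have "\<phi> (act f (T v)) = 0" for f
        by (simp add: act_T)
      then show ?thesis
        using v V by (simp add: W_def invariant_subspace_def)
    qed
    ultimately show "invariant_subspace W"
      by (simp add: invariant_subspace_def)
    show "act f w = 0" if f: "act f w \<in> W" for f
    proof (rule ccontr)
      assume nz: "act f w \<noteq> 0"
      define r where "r = f mod m"
      have r: "act r w = act f w" "degree r < d"
        using act_mod[OF w(1)] mod_deg by (auto simp: r_def)
      then have "r \<noteq> 0"
        using nz by auto
      \<comment> \<open>the shift that moves the leading coefficient to degree \<open>d - 1\<close>\<close>
      let ?g = "monom 1 (d - 1 - degree r) * r"
      have deg: "degree ?g = d - 1"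
        using \<open>r \<noteq> 0\<close> r(2) by (simp add: degree_mult_eq degree_monom_eq monom_eq_0_iff)
      have "\<phi> (act ?g w) = lead_coeff ?g"
        using \<phi>_act[of ?g] deg d0 by simp
      also have "\<dots> \<noteq> 0"
        using \<open>r \<noteq> 0\<close> by (simp add: monom_eq_0_iff)
      finally have "\<phi> (act (monom 1 (d - 1 - degree r)) (act f w)) \<noteq> 0"
        by (simp add: act_mult r(1))
      then show False
        using f by (simp add: W_def)
    qed
    fix v
    assume v: "v \<in> V"
    \<comment> \<open>back substitution: the coefficient of degree \<open>d - 1 - k\<close> corrects the condition for \<open>i = k\<close>
      and leaves those for \<open>i < k\<close> untouched\<close>
    have "\<exists>f. \<forall>i<k. \<phi> (act (monom 1 i) (v - act f w)) = 0" if "k \<le> d" for k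
      using that
    proof (induction k)
      case 0
      then show ?case
        by simp
    next
      case (Suc k)
      then obtain f where f: "\<forall>i<k. \<phi> (act (monom 1 i) (v - act f w)) = 0"
        by auto
      define c where "c = \<phi> (act (monom 1 k) (v - act f w))"
      let ?g = "f + monom c (d - 1 - k)"
      have "\<phi> (act (monom 1 i) (v - act ?g w)) = 0" if i: "i < Suc k" for i
      proof -
        have "act (monom 1 i) (act (monom c (d - 1 - k)) w) = act (monom c (i + (d - 1 - k))) w"
          by (simp add: mult_monom flip: act_mult)
        moreover have "degree (monom c (i + (d - 1 - k))) < d"
          using i Suc.prems degree_monom_le[of c "i + (d - 1 - k)"] by linarith
        ultimately have "\<phi> (act (monom 1 i) (act (monom c (d - 1 - k)) w))
            = (if i = k then c else 0)"
          using i Suc.prems by (auto simp: \<phi>_act)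
        moreover have "act (monom 1 i) (v - act ?g w)
            = act (monom 1 i) (v - act f w) - act (monom 1 i) (act (monom c (d - 1 - k)) w)"
          by (simp add: act_add act_diff_right act_add_right)
        ultimately show ?thesis
          using f i by (auto simp: \<phi>_diff c_def less_Suc_eq)
      qed
      then show ?case
        by blast
    qed
    from this[of d] obtain f where
      f: "\<And>i. i < d \<Longrightarrow> \<phi> (act (monom 1 i) (v - act f w)) = 0"
      by auto
    have inV: "v - act f w \<in> V"
      using v act_in_invariant[OF V w(1)] subspace_diff[OF sub] by blast
    have "\<phi> (act g (v - act f w)) = 0" for g
    proof -
      have "\<phi> (act g (v - act f w)) = \<phi> (act (g mod m) (v - act f w))"
        by (simp add: act_mod[OF inV])
      also have "\<dots> = (\<Sum>i<d. coeff (g mod m) i * \<phi> (act (monom 1 i) (v - act f w)))"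
        by (subst act_as_sum[OF mod_deg]) (simp add: \<phi>_sum \<phi>_scale)
      also have "\<dots> = 0"
        by (simp add: f)
      finally show ?thesis .
    qed
    with inV have "v - act f w \<in> W"
      by (simp add: W_def)
    moreover have "v = act f w + (v - act f w)"
      by simp
    ultimately show "\<exists>f. \<exists>z\<in>W. v = act f w + z"
      by blast
  qed
qed

end

section \<open>From a solution of the commutator equation to an idempotent one\<close>

text \<open>
  In characteristic \<open>2\<close> the polynomial \<open>f + t f'\<close> is the even part of \<open>f\<close>, so this is the projection
  onto the even part followed by multiplication with \<open>1 + b t\<close>. It is idempotent because the even
  part of \<open>(1 + b t) g\<close> is \<open>g\<close> whenever \<open>g\<close> is even.
\<close>

definition idem_symbol :: "'a :: field \<Rightarrow> 'a poly \<Rightarrow> 'a poly" where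
  "idem_symbol b f = [:1, b:] * (f + [:0, 1:] * pderiv f)"

lemma idem_symbol_add: "idem_symbol b (f + g) = idem_symbol b f + idem_symbol b g"
  by (simp only: idem_symbol_def pderiv_add ring_distribs add_ac)

lemma idem_symbol_diff: "idem_symbol b (f - g) = idem_symbol b f - idem_symbol b g"
  using idem_symbol_add[of b "f - g" g] by (simp add: algebra_simps)

lemma idem_symbol_smult: "idem_symbol b (smult c f) = smult c (idem_symbol b f)"
  by (simp only: idem_symbol_def pderiv_smult mult_smult_right flip: smult_add_right)

lemma idem_symbol_idem:
  fixes f :: "'a :: field poly"
  assumes "CHAR('a) = 2"
  shows "idem_symbol b (idem_symbol b f) = idem_symbol b f"
proof -
  let ?t = "[:0, 1:] :: 'a poly"
  let ?g = "f + ?t * pderiv f"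
  have "pderiv ?g = pderiv f + (pderiv f + ?t * pderiv (pderiv f))"
    by (simp add: pderiv_add pderiv_mult pderiv_pCons)
  also have "\<dots> = 0"
    using char_2_poly_double[OF assms] by (simp add: char_2_pderiv_pderiv[OF assms])
  finally have g: "pderiv ?g = 0" .
  have "idem_symbol b ([:1, b:] * ?g) = [:1, b:] * (([:1, b:] + ?t * [:b:]) * ?g)"
    unfolding idem_symbol_def pderiv_mult g
    by (simp only: mult_zero_right add_0_left add_0_right pderiv_pCons pderiv_singleton pderiv_0)
       (simp only: algebra_simps pCons_0_0 add_0_left add_0_right)
  also have "[:1, b:] + ?t * [:b:] = 1 + ([:0, b:] + [:0, b:])"
    by (simp add: one_pCons)
  also have "\<dots> = 1"
    by (simp only: char_2_poly_double[OF assms] add_0_right)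
  finally show ?thesis
    by (simp add: idem_symbol_def)
qed

text \<open>
  The map solves the commutator equation for multiplication by \<open>t\<close>.
\<close>

lemma idem_symbol_times_X:
  fixes f :: "'a :: field poly"
  assumes "CHAR('a) = 2"
  shows "idem_symbol b ([:0, 1:] * f) + [:0, 1:] * idem_symbol b f = [:0, 1, b:] * f"
proof -
  let ?t = "[:0, 1:] :: 'a poly" and ?u = "[:1, b:]"
  have "pderiv (?t * f) = f + ?t * pderiv f"
    by (simp add: pderiv_mult pderiv_pCons)
  then have "idem_symbol b (?t * f) + ?t * idem_symbol b f
      = ?t * ?u * f + ((?t * ?u * (f + ?t * pderiv f)) + (?t * ?u * (f + ?t * pderiv f)))"
    unfolding idem_symbol_def by (simp only: algebra_simps)
  also have "\<dots> = ?t * ?u * f"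
    by (simp only: char_2_poly_double[OF assms] add_0_right)
  finally show ?thesis
    by simp
qed

text \<open>
  By the product rule the map sends \<open>m g\<close> to a multiple of \<open>m\<close> plus \<open>m' (t + b t\<^sup>2) g\<close>, so under the
  first assumption it induces a map on \<open>K[t]/(m)\<close>.
\<close>

lemma idem_symbol_preserves_ideal:
  assumes "m dvd pderiv m * [:0, 1, b:]" "m dvd f"
  shows "m dvd idem_symbol b f"
proof -
  obtain g where g: "f = m * g"
    using assms(2) ..
  have "[:0, 1, b:] = [:1, b:] * [:0, 1:]"
    by simp
  then have "idem_symbol b f = m * ([:1, b:] * (g + [:0, 1:] * pderiv g)) + pderiv m * [:0, 1, b:] * g"
    unfolding idem_symbol_def g pderiv_mult by (simp only: algebra_simps)
  then show ?thesis
    using assms(1) by (metis dvd_add dvd_mult2 dvd_triv_left)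
qed

locale char_2_operator = linear_operator scale T
  for scale :: "'a :: field \<Rightarrow> 'b :: ab_group_add \<Rightarrow> 'b" (infixr "*s" 75) and T :: "'b \<Rightarrow> 'b" +
  assumes char_2: "CHAR('a) = 2"
begin

lemma add_self [simp]: "v + v = (0 :: 'b)"
  using char_2_double[OF char_2, of 1] by (metis scale_left_distrib scale_one scale_zero_left)

lemma add_eq_iff_add: "u + v = w \<longleftrightarrow> u = w + (v :: 'b)"
  by (metis add.assoc add_0_right add_self)

definition solves_on :: "'a \<Rightarrow> 'b set \<Rightarrow> ('b \<Rightarrow> 'b) \<Rightarrow> bool" where
  "solves_on b V P \<longleftrightarrow> lin_on V P \<and> (\<forall>v\<in>V. P (T v) + T (P v) = T v + b *s T (T v))"

lemma act_quadratic: "act (f * [:0, 1, b:]) v = T (act f v) + b *s T (T (act f v))"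
proof -
  have "act (f * [:0, 1, b:]) v = act [:0, 1, b:] (act f v)"
    by (metis act_mult act_commute)
  then show ?thesis
    by (simp add: T_add T_scale)
qed

text \<open>
  Taking the commutator with \<open>P\<close> is a derivation on polynomials in \<open>T\<close> that sends \<open>T\<close> to
  \<open>T + b T\<^sup>2\<close>, which commutes with \<open>T\<close>; hence it is \<open>(t + b t\<^sup>2) d/dt\<close>.
\<close>

lemma commutator_act:
  assumes V: "invariant_subspace V" and P: "solves_on b V P" and v: "v \<in> V"
  shows "P (act f v) + act f (P v) = act (pderiv f * [:0, 1, b:]) v"
proof (induction f)
  case 0
  have "P (0 *s v) = 0 *s P v"
    using P v unfolding solves_on_def lin_on_def by blast
  then show ?case
    by simp
next
  case (pCons a f)
  let ?u = "act f v"
  have sub: "subspace V" and u: "?u \<in> V" "T ?u \<in> V"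
    using V v act_in_invariant[OF V v] by (auto simp: invariant_subspace_def)
  have "P (a *s v + T ?u) = P (a *s v) + P (T ?u)"
    using P v u subspace_scale[OF sub v] unfolding solves_on_def lin_on_def by blast
  also have "P (a *s v) = a *s P v"
    using P v unfolding solves_on_def lin_on_def by blast
  also have "P (T ?u) = T ?u + b *s T (T ?u) + T (P ?u)"
    using P u unfolding solves_on_def add_eq_iff_add by blast
  finally have "P (act (pCons a f) v) + act (pCons a f) (P v)
      = (a *s P v + a *s P v) + (T ?u + b *s T (T ?u)) + (T (P ?u) + T (act f (P v)))"
    by (simp only: act_pCons add_ac)
  also have "\<dots> = (T ?u + b *s T (T ?u)) + T (P ?u + act f (P v))"
    by (simp add: T_add)
  also have "\<dots> = act (f * [:0, 1, b:]) v + T (act (pderiv f * [:0, 1, b:]) v)"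
    by (simp only: pCons act_quadratic)
  also have "\<dots> = act (pderiv (pCons a f) * [:0, 1, b:]) v"
    by (simp only: pderiv_pCons ring_distribs act_add mult_pCons_left smult_0_left add_0_left act_pCons scale_zero_left)
  finally show ?case .
qed

text \<open>
  Split \<open>V\<close> into a cyclic subspace, with generator \<open>w\<close> and annihilator \<open>(m)\<close>, and an invariant
  complement \<open>W\<close>. The projection \<open>Z\<close> onto \<open>W\<close> along the cyclic part commutes with \<open>T\<close>, so \<open>Z P\<close>
  solves the equation on \<open>W\<close> and induction provides an idempotent solution \<open>Q\<close> there. On the cyclic
  part, which is \<open>K[t]/(m)\<close>, use the map \<open>idem_symbol\<close>; the map \<open>R\<close> below is the sum of both.
\<close>

lemma ex_idempotent_solution:
  assumes "invariant_subspace V" "dim_at_most n V" "solves_on b V P"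
  shows "\<exists>Q. solves_on b V Q \<and> (\<forall>v\<in>V. Q (Q v) = Q v)"
  using assms
proof (induction n arbitrary: V P rule: less_induct)
  case (less n)
  note V = less.prems(1) and fin = less.prems(2) and P = less.prems(3)
  have sub: "subspace V"
    using V by (simp add: invariant_subspace_def)
  show ?case
  proof (cases "V = {0}")
    case True
    then show ?thesis
      by (intro exI[of _ "\<lambda>v. 0"]) (simp add: solves_on_def lin_on_def)
  next
    case False
    from cyclic_summand[OF V fin False] obtain w m W where
      w: "w \<in> V" "w \<noteq> 0" and m: "ann_generator w m" and kill: "\<And>v. v \<in> V \<Longrightarrow> act m v = 0"
      and W: "invariant_subspace W" "W \<subseteq> V"
      and decomp: "\<And>v. v \<in> V \<Longrightarrow> \<exists>f. \<exists>z\<in>W. v = act f w + z"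
      and disj: "\<And>f. act f w \<in> W \<Longrightarrow> act f w = 0"
      by metis
    have subW: "subspace W"
      using W by (simp add: invariant_subspace_def)
    have mw: "act f w = 0 \<longleftrightarrow> m dvd f" for f
      using m by (simp add: ann_generator_def)
    have "w \<notin> W"
      using disj[of 1] w by auto
    \<comment> \<open>adding \<open>w\<close> to an independent subset of \<open>W\<close> keeps it independent, so \<open>W\<close> has smaller dimension\<close>
    have bound: "finite B \<and> Suc (card B) \<le> n" if B: "B \<subseteq> W" "independent B" for B
    proof -
      have "w \<notin> span B"
        using span_minimal[OF B(1) subW] \<open>w \<notin> W\<close> by blast
      then have "independent (insert w B)" "w \<notin> B"
        using independent_insertI[OF _ B(2)] span_base by blast+
      have "insert w B \<subseteq> V"
        using w B W by blast
      from dim_at_mostD[OF fin \<open>independent (insert w B)\<close> this] show ?thesis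
        using \<open>w \<notin> B\<close> by simp
    qed
    have "n > 0"
      using bound[OF empty_subsetI independent_empty] by simp
    have finW: "dim_at_most (n - 1) W"
      unfolding dim_at_most_def
    proof (intro allI impI)
      fix B
      assume "B \<subseteq> W" "independent B"
      from bound[OF this] show "finite B \<and> card B \<le> n - 1"
        by auto
    qed
    \<comment> \<open>\<open>F v\<close> is a polynomial representing the cyclic component of \<open>v\<close>; it is determined modulo \<open>m\<close> only\<close>
    define F where "F v = (SOME f. v - act f w \<in> W)" for v
    define Z where "Z v = v - act (F v) w" for v
    have FZ: "Z v \<in> W" "v = act (F v) w + Z v" if v: "v \<in> V" for v
    proof -
      obtain f z where "z \<in> W" "v = act f w + z"
        using decomp[OF v] by blast
      then have "v - act f w \<in> W"
        by simp
      then show "Z v \<in> W"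
        unfolding F_def Z_def by (rule someI)
      show "v = act (F v) w + Z v"
        by (simp add: Z_def)
    qed
    have uniq: "Z (act f w + z) = z" "m dvd F (act f w + z) - f" if z: "z \<in> W" for f z
    proof -
      let ?v = "act f w + z"
      have "?v \<in> V"
        using z W(2) act_in_invariant[OF V w(1)] subspace_add[OF sub] by blast
      from FZ[OF this] have Zv: "Z ?v \<in> W" and eq: "?v = act (F ?v) w + Z ?v"
        by blast+
      have "act (F ?v - f) w = z - Z ?v"
        using eq by (simp add: act_diff algebra_simps)
      moreover have "z - Z ?v \<in> W"
        using z Zv subspace_diff[OF subW] by blast
      ultimately have *: "act (F ?v - f) w = 0" "z - Z ?v = 0"
        using disj[of "F ?v - f"] by simp_all
      show "Z ?v = z"
        using *(2) by simp
      show "m dvd F ?v - f"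
        using *(1) mw by blast
    qed
    have t: "act ([:0, 1:] * f) u = T (act f u)" for f u
      by (simp only: act_mult act_pCons act_0 T_zero scale_zero_left scale_one add_0_left add_0_right)
    have sum_form: "u + v = act (F u + F v) w + (Z u + Z v)" if "u \<in> V" "v \<in> V" for u v
    proof -
      have "u + v = (act (F u) w + Z u) + (act (F v) w + Z v)"
        using FZ(2) that by simp
      then show ?thesis
        by (simp only: act_add add_ac)
    qed
    have scale_form: "c *s v = act (smult c (F v)) w + c *s Z v" if "v \<in> V" for c v
      using FZ(2)[OF that] by (metis act_smult scale_right_distrib)
    have T_form: "T v = act ([:0, 1:] * F v) w + T (Z v)" if "v \<in> V" for v
      using FZ(2)[OF that] by (metis t T_add)
    have Z_add: "Z (u + v) = Z u + Z v" if "u \<in> V" "v \<in> V" for u v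
      unfolding sum_form[OF that]
      by (rule uniq(1)[OF subspace_add[OF subW FZ(1)[OF that(1)] FZ(1)[OF that(2)]]])
    have Z_scale: "Z (c *s v) = c *s Z v" if "v \<in> V" for c v
      unfolding scale_form[OF that] by (rule uniq(1)[OF subspace_scale[OF subW FZ(1)[OF that]]])
    have T_W: "T z \<in> W" if "z \<in> W" for z
      using W(1) that by (simp add: invariant_subspace_def)
    have Z_T: "Z (T v) = T (Z v)" if "v \<in> V" for v
      unfolding T_form[OF that] by (rule uniq(1)[OF T_W[OF FZ(1)[OF that]]])
    have Z_W: "Z z = z" if "z \<in> W" for z
      using uniq(1)[OF that, of 0] by simp
    have "solves_on b W (\<lambda>z. Z (P z))"
    proof -
      have PV: "P z \<in> V" if "z \<in> W" for z
        using that W(2) P unfolding solves_on_def lin_on_def by blast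
      have "Z (P (T z)) + T (Z (P z)) = T z + b *s T (T z)" if z: "z \<in> W" for z
      proof -
        have zV: "z \<in> V" "T z \<in> W" "T (T z) \<in> W"
          using z W by (auto simp: invariant_subspace_def)
        have "T (P z) \<in> V"
          using PV[OF z] V by (simp add: invariant_subspace_def)
        then have "Z (P (T z)) + T (Z (P z)) = Z (P (T z) + T (P z))"
          using PV z zV(2) by (simp add: Z_add Z_T)
        also have "P (T z) + T (P z) = T z + b *s T (T z)"
          using P zV(1) unfolding solves_on_def by blast
        also have "Z \<dots> = T z + b *s T (T z)"
          by (rule Z_W[OF subspace_add[OF subW zV(2) subspace_scale[OF subW zV(3)]]])
        finally show ?thesis .
      qed
      moreover have "lin_on W (\<lambda>z. Z (P z))"
      proof -
        have "P (u + v) = P u + P v" "P (c *s v) = c *s P v" if "u \<in> W" "v \<in> W" for u v c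
          using that W(2) P unfolding solves_on_def lin_on_def by blast+
        then show ?thesis
          unfolding lin_on_def using PV FZ(1) by (simp add: Z_add Z_scale)
      qed
      ultimately show ?thesis
        by (simp add: solves_on_def)
    qed
    then obtain Q where Q: "solves_on b W Q" "\<forall>z\<in>W. Q (Q z) = Q z"
      using less.IH[of "n - 1" W] \<open>n > 0\<close> W(1) finW by auto
    have QW: "Q z \<in> W" if "z \<in> W" for z
      using that Q(1) unfolding solves_on_def lin_on_def by blast
    \<comment> \<open>as \<open>m\<close> kills both \<open>w\<close> and \<open>P w\<close>, the commutator of \<open>P\<close> with \<open>m(T)\<close> vanishes at \<open>w\<close>\<close>
    have "m dvd pderiv m * [:0, 1, b:]"
    proof -
      have "P w \<in> V"
        using P w(1) unfolding solves_on_def lin_on_def by blast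
      moreover have "P (0 *s w) = 0 *s P w"
        using P w(1) unfolding solves_on_def lin_on_def by blast
      ultimately have "act (pderiv m * [:0, 1, b:]) w = 0"
        using commutator_act[OF V P w(1), of m] kill w(1) by simp
      then show ?thesis
        using mw by blast
    qed
    note ideal = idem_symbol_preserves_ideal[OF this]
    define R where "R v = act (idem_symbol b (F v)) w + Q (Z v)" for v
    have R: "R (act f w + z) = act (idem_symbol b f) w + Q z" if "z \<in> W" for f z
    proof -
      let ?v = "act f w + z"
      have "m dvd idem_symbol b (F ?v) - idem_symbol b f"
        using ideal[OF uniq(2)[OF that]] by (simp add: idem_symbol_diff)
      then have "act (idem_symbol b (F ?v)) w = act (idem_symbol b f) w"
        using mw[of "idem_symbol b (F ?v) - idem_symbol b f"] by (simp add: act_diff)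
      then show ?thesis
        by (simp add: R_def uniq(1)[OF that])
    qed
    have "lin_on V R"
    proof -
      have "R v \<in> V" if "v \<in> V" for v
        unfolding R_def using that act_in_invariant[OF V w(1)] subspace_add[OF sub] QW FZ(1) W(2)
        by blast
      moreover have "R (u + v) = R u + R v" if "u \<in> V" "v \<in> V" for u v
      proof -
        have "Q (Z u + Z v) = Q (Z u) + Q (Z v)"
          using Q(1) FZ(1) that unfolding solves_on_def lin_on_def by blast
        moreover have "R (u + v) = act (idem_symbol b (F u + F v)) w + Q (Z u + Z v)"
          unfolding sum_form[OF that] by (rule R[OF subspace_add[OF subW FZ(1)[OF that(1)] FZ(1)[OF that(2)]]])
        ultimately show ?thesis
          unfolding R_def[of u] R_def[of v] by (simp only: idem_symbol_add act_add add_ac)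
      qed
      moreover have "R (c *s v) = c *s R v" if "v \<in> V" for c v
      proof -
        have "Q (c *s Z v) = c *s Q (Z v)"
          using Q(1) FZ(1) that unfolding solves_on_def lin_on_def by blast
        moreover have "R (c *s v) = act (idem_symbol b (smult c (F v))) w + Q (c *s Z v)"
          unfolding scale_form[OF that] by (rule R[OF subspace_scale[OF subW FZ(1)[OF that]]])
        ultimately show ?thesis
          unfolding R_def[of v] by (simp only: idem_symbol_smult act_smult scale_right_distrib)
      qed
      ultimately show ?thesis
        by (simp add: lin_on_def)
    qed
    moreover have "R (T v) + T (R v) = T v + b *s T (T v)" if v: "v \<in> V" for v
    proof -
      let ?f = "F v" and ?z = "Z v"
      have z: "?z \<in> W" "T ?z \<in> W"
        using FZ(1)[OF v] W by (auto simp: invariant_subspace_def)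
      have "R (T v) + T (R v) = act (idem_symbol b ([:0, 1:] * ?f) + [:0, 1:] * idem_symbol b ?f) w
          + (Q (T ?z) + T (Q ?z))"
        unfolding T_form[OF v] R[OF z(2)] unfolding R_def[of v] by (simp only: t act_add T_add add_ac)
      also have "\<dots> = act (?f * [:0, 1, b:]) w + (T ?z + b *s T (T ?z))"
        using Q(1) z(1) unfolding solves_on_def by (simp only: idem_symbol_times_X[OF char_2] mult.commute[of ?f "[:0, 1, b:]"])
      also have "\<dots> = T (act ?f w + ?z) + b *s T (T (act ?f w + ?z))"
        by (simp only: act_quadratic T_add scale_right_distrib add_ac)
      finally show ?thesis
        by (simp only: FZ(2)[OF v, symmetric])
    qed
    moreover have "R (R v) = R v" if v: "v \<in> V" for v
      using R[OF QW[OF FZ(1)[OF v]], of "idem_symbol b (F v)"] Q(2) FZ(1)[OF v]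
      by (simp add: R_def[of v] idem_symbol_idem[OF char_2])
    ultimately show ?thesis
      unfolding solves_on_def by blast
  qed
qed

end

section \<open>Jordan normal form over an algebraically closed field\<close>

lemma ex_invertible_first_column:
  fixes v :: "'a :: field vec"
  assumes v: "v \<in> carrier_vec n" "v \<noteq> 0\<^sub>v n" and n: "n > 0"
  obtains S T where "S \<in> carrier_mat n n" "T \<in> carrier_mat n n" "S * T = 1\<^sub>m n" "T * S = 1\<^sub>m n"
    "col S 0 = v"
proof -
  interpret vec_space "TYPE('a)" n .
  let ?b = "basis_completion v"
  let ?S = "mat_of_cols n ?b"
  note b = basis_completion[OF v]
  have S: "?S \<in> carrier_mat n n"
    using mat_of_cols_carrier(1)[of n ?b] b(6) by simp
  have "rank ?S = n"
    using b(2,4,5) by (intro lin_indpt_full_rank[OF S]) (simp_all add: cols_mat_of_cols)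
  then have det: "det ?S \<noteq> 0"
    using det_rank_iff[OF S] by simp
  from det_non_zero_imp_unit[OF S this, of b] obtain T
    where T: "T \<in> carrier_mat n n" "T * ?S = 1\<^sub>m n"
    unfolding Units_def ring_mat_def by auto
  have "?S * T = 1\<^sub>m n"
    using mat_mult_left_right_inverse[OF T(1) S T(2)] .
  moreover have "col ?S 0 = v"
  proof -
    have "?b ! 0 = v"
      using b(6,7) n by (metis hd_conv_nth list.size(3) not_less_zero)
    then show ?thesis
      using v b(6) n by simp
  qed
  ultimately show thesis
    using that[OF S T(1) _ T(2)] by blast
qed

text \<open>
  Deflation: completing an eigenvector to a basis brings \<open>A\<close> into block triangular form with a
  \<open>1 \<times> 1\<close> block in the upper left corner, and induction triangularises the other diagonal block.
\<close>

lemma similar_to_upper_triangular: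
  fixes A :: "'a :: alg_closed_field mat"
  assumes "A \<in> carrier_mat n n"
  shows "\<exists>B \<in> carrier_mat n n. upper_triangular B \<and> similar_mat A B"
  using assms
proof (induction n arbitrary: A)
  case 0
  then show ?case
    by (intro bexI[of _ A]) (auto intro: similar_mat_refl)
next
  case (Suc n)
  note A = Suc.prems
  have "degree (char_poly A) > 0"
    using degree_monic_char_poly[OF A] by simp
  then obtain e where "poly (char_poly A) e = 0"
    using alg_closed_imp_poly_has_root[of "char_poly A"] by blast
  then obtain v where "eigenvector A v e"
    using eigenvalue_root_char_poly[OF A] by (auto simp: eigenvalue_def)
  then have v: "v \<in> carrier_vec (Suc n)" "v \<noteq> 0\<^sub>v (Suc n)" "A *\<^sub>v v = e \<cdot>\<^sub>v v"
    using A by (auto simp: eigenvector_def)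
  obtain S T where S: "S \<in> carrier_mat (Suc n) (Suc n)" and T: "T \<in> carrier_mat (Suc n) (Suc n)"
    and ST: "S * T = 1\<^sub>m (Suc n)" and TS: "T * S = 1\<^sub>m (Suc n)" and col: "col S 0 = v"
    using ex_invertible_first_column[OF v(1,2)] by blast
  define B where "B = T * A * S"
  have B: "B \<in> carrier_mat (Suc n) (Suc n)"
    using A S T by (simp add: B_def)
  have "S * B * T = S * (T * A * S) * T"
    by (simp add: B_def)
  also have "\<dots> = (S * T) * A * (S * T)"
    using A S T by (simp add: assoc_mult_mat[of _ "Suc n" "Suc n" _ "Suc n" _ "Suc n"])
  also have "\<dots> = A"
    using A by (simp add: ST)
  finally have sim: "similar_mat A B"
    using A B S T ST TS by (intro similar_matI[of _ _ S T "Suc n"]) auto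
  have "B = T * (A * S)"
    unfolding B_def using A S T by (intro assoc_mult_mat) auto
  then have "col B 0 = T *\<^sub>v col (A * S) 0"
    using col_mult2[OF T mult_carrier_mat[OF A S], of 0] by simp
  also have "col (A * S) 0 = A *\<^sub>v col S 0"
    using col_mult2[OF A S, of 0] by simp
  also have "T *\<^sub>v (A *\<^sub>v col S 0) = e \<cdot>\<^sub>v (T *\<^sub>v col S 0)"
    using T v by (simp add: col mult_mat_vec)
  also have "T *\<^sub>v col S 0 = col (T * S) 0"
    using col_mult2[OF T S, of 0] by simp
  finally have col_B: "col B 0 = e \<cdot>\<^sub>v unit_vec (Suc n) 0"
    by (simp add: TS)
  have B0: "B $$ (Suc i, 0) = 0" if "i < n" for i
  proof -
    have "B $$ (Suc i, 0) = col B 0 $ Suc i"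
      using that B by simp
    then show ?thesis
      using that by (simp add: col_B)
  qed
  obtain B1 B2 B3 B4 where split: "split_block B 1 1 = (B1, B2, B3, B4)"
    by (cases "split_block B 1 1") auto
  have dims: "dim_row B = 1 + n" "dim_col B = 1 + n"
    using B by auto
  note blocks = split_block[OF split dims]
  have "B3 = 0\<^sub>m n 1"
    using split B B0 by (auto simp: split_block_def Let_def)
  from Suc.IH[OF blocks(4)] obtain U
    where U: "U \<in> carrier_mat n n" "upper_triangular U" "similar_mat B4 U"
    by blast
  obtain C where C: "C \<in> carrier_mat 1 n"
    "similar_mat (four_block_mat B1 B2 (0\<^sub>m n 1) B4) (four_block_mat B1 C (0\<^sub>m n 1) U)"
    using similar_mat_four_block_0_ex[OF similar_mat_refl[OF blocks(1)] U(3) blocks(2,1,4)] by blast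
  let ?D = "four_block_mat B1 C (0\<^sub>m n 1) U"
  have "similar_mat A ?D"
    using similar_mat_trans[OF sim] C(2) blocks(5) \<open>B3 = 0\<^sub>m n 1\<close> by simp
  moreover have "?D \<in> carrier_mat (Suc n) (Suc n)"
    using four_block_carrier_mat[OF blocks(1) U(1)] by simp
  moreover have "upper_triangular ?D"
    using blocks(1) by (intro upper_triangular_four_block[OF blocks(1) U(1) _ U(2)]) auto
  ultimately show ?case
    by blast
qed

lemma jordan_nf_exists_alg_closed:
  fixes A :: "'a :: alg_closed_field mat"
  assumes "A \<in> carrier_mat n n"
  shows "\<exists>n_as. jordan_nf A n_as"
proof -
  obtain B where B: "B \<in> carrier_mat n n" "upper_triangular B" "similar_mat A B"
    using similar_to_upper_triangular[OF assms] by blast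
  have "jordan_nf B (triangular_to_jnf_vector B)"
    using triangular_to_jnf_vector[OF B(1,2)] .
  then show ?thesis
    using similar_mat_trans[OF B(3)] by (auto simp: jordan_nf_def)
qed

section \<open>The linear commutator equation for matrices\<close>

definition commutator_solvable :: "nat \<Rightarrow> 'a :: field \<Rightarrow> 'a mat \<Rightarrow> bool" where
  "commutator_solvable n b A \<longleftrightarrow> (\<exists>P \<in> carrier_mat n n. P * A + A * P = A + b \<cdot>\<^sub>m (A * A))"

lemma commutator_solvable_similar:
  fixes A B :: "'a :: field mat"
  assumes sim: "similar_mat A B" and A: "A \<in> carrier_mat n n" and B: "commutator_solvable n b B"
  shows "commutator_solvable n b A"
proof -
  obtain S T where "similar_mat_wit A B S T"
    using sim by (auto simp: similar_mat_def)
  note ST = similar_mat_witD2[OF A this]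
  obtain P where P: "P \<in> carrier_mat n n" "P * B + B * P = B + b \<cdot>\<^sub>m (B * B)"
    using B by (auto simp: commutator_solvable_def)
  have cancel: "T * (S * M) = M" if "M \<in> carrier_mat n n" for M
  proof -
    have "T * (S * M) = (T * S) * M"
      using ST that by (intro assoc_mult_mat[symmetric]) auto
    then show ?thesis
      using ST that by simp
  qed
  have conj_mult: "(S * M * T) * (S * N * T) = S * (M * N) * T"
    if "M \<in> carrier_mat n n" "N \<in> carrier_mat n n" for M N
    using ST that by (simp add: assoc_mult_mat[of _ n n _ n _ n] cancel)
  have conj_add: "S * M * T + S * N * T = S * (M + N) * T"
    if "M \<in> carrier_mat n n" "N \<in> carrier_mat n n" for M N
    using ST that by (simp add: mult_add_distrib_mat[of _ n n _ n] add_mult_distrib_mat[of _ n n _ _ n])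
  have conj_smult: "c \<cdot>\<^sub>m (S * M * T) = S * (c \<cdot>\<^sub>m M) * T" if "M \<in> carrier_mat n n" for M c
    using ST that
    by (simp add: mult_smult_distrib[of _ n n _ n] mult_smult_assoc_mat[of _ n n _ n])
  have A_eq: "A = S * B * T" and B_carrier: "B \<in> carrier_mat n n"
    using ST by auto
  show ?thesis
    unfolding commutator_solvable_def
  proof (intro bexI)
    show "S * P * T \<in> carrier_mat n n"
      using ST P by auto
    have carriers: "P * B \<in> carrier_mat n n" "B * P \<in> carrier_mat n n" "B * B \<in> carrier_mat n n"
      "b \<cdot>\<^sub>m (B * B) \<in> carrier_mat n n"
      using P B_carrier by auto
    show "S * P * T * A + A * (S * P * T) = A + b \<cdot>\<^sub>m (A * A)"
      unfolding A_eq conj_mult[OF P(1) B_carrier] conj_mult[OF B_carrier P(1)]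
        conj_mult[OF B_carrier B_carrier] conj_smult[OF carriers(3)]
        conj_add[OF carriers(1,2)] conj_add[OF B_carrier carriers(4)]
      by (simp only: P(2))
  qed
qed

lemma four_block_mat_diag_inj:
  assumes "four_block_mat A B C D = four_block_mat A' B' C' D'"
    and A: "A \<in> carrier_mat n n" "A' \<in> carrier_mat n n"
    and D: "D \<in> carrier_mat m m" "D' \<in> carrier_mat m m"
  shows "A = A'" "D = D'"
proof -
  have entry: "four_block_mat A B C D $$ (i, j) = four_block_mat A' B' C' D' $$ (i, j)" for i j
    by (simp only: assms(1))
  show "A = A'"
  proof (rule eq_matI)
    fix i j
    assume "i < dim_row A'" "j < dim_col A'"
    then show "A $$ (i, j) = A' $$ (i, j)"
      using entry[of i j] A D by simp
  qed (use A in auto)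
  show "D = D'"
  proof (rule eq_matI)
    fix i j
    assume "i < dim_row D'" "j < dim_col D'"
    then show "D $$ (i, j) = D' $$ (i, j)"
      using entry[of "n + i" "n + j"] A D by simp
  qed (use D in auto)
qed

text \<open>
  The diagonal blocks of a solution for the direct sum solve the equations of the summands, whatever
  its off-diagonal blocks are.
\<close>

lemma commutator_solvable_four_block:
  fixes A D :: "'a :: field mat"
  assumes A: "A \<in> carrier_mat n n" and D: "D \<in> carrier_mat m m"
  shows "commutator_solvable (n + m) b (four_block_mat A (0\<^sub>m n m) (0\<^sub>m m n) D) \<longleftrightarrow>
    commutator_solvable n b A \<and> commutator_solvable m b D"
proof -
  let ?F = "four_block_mat A (0\<^sub>m n m) (0\<^sub>m m n) D"
  have eq: "four_block_mat P R S Q * ?F + ?F * four_block_mat P R S Q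
      = four_block_mat (P * A + A * P) (R * D + A * R) (S * A + D * S) (Q * D + D * Q)"
    if "P \<in> carrier_mat n n" "R \<in> carrier_mat n m" "S \<in> carrier_mat m n" "Q \<in> carrier_mat m m"
    for P Q R S
    using that A D
    by (simp add: mult_four_block_mat[of _ n n _ m _ m _ _ n _ m] add_four_block_mat[of _ n n _ m _ m])
  have rhs: "?F + b \<cdot>\<^sub>m (?F * ?F)
      = four_block_mat (A + b \<cdot>\<^sub>m (A * A)) (0\<^sub>m n m) (0\<^sub>m m n) (D + b \<cdot>\<^sub>m (D * D))"
    using A D
    by (simp add: mult_four_block_mat[of _ n n _ m _ m _ _ n _ m] add_four_block_mat[of _ n n _ m _ m]
        smult_four_block_mat[of _ n n _ m _ m])
  show ?thesis
  proof
    assume "commutator_solvable (n + m) b ?F"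
    then obtain M where M: "M \<in> carrier_mat (n + m) (n + m)" "M * ?F + ?F * M = ?F + b \<cdot>\<^sub>m (?F * ?F)"
      by (auto simp: commutator_solvable_def)
    obtain P R S Q where split: "split_block M n n = (P, R, S, Q)"
      by (cases "split_block M n n") auto
    have "dim_row M = n + m" "dim_col M = n + m"
      using M by auto
    note blocks = split_block[OF split this]
    have "four_block_mat (P * A + A * P) (R * D + A * R) (S * A + D * S) (Q * D + D * Q)
        = four_block_mat (A + b \<cdot>\<^sub>m (A * A)) (0\<^sub>m n m) (0\<^sub>m m n) (D + b \<cdot>\<^sub>m (D * D))"
      using M(2) unfolding blocks(5) eq[OF blocks(1-4)] rhs .
    from four_block_mat_diag_inj[OF this, of n m]
    have "P * A + A * P = A + b \<cdot>\<^sub>m (A * A)" "Q * D + D * Q = D + b \<cdot>\<^sub>m (D * D)"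
      using A D blocks by auto
    then show "commutator_solvable n b A \<and> commutator_solvable m b D"
      using blocks unfolding commutator_solvable_def by blast
  next
    assume "commutator_solvable n b A \<and> commutator_solvable m b D"
    then obtain P Q where P: "P \<in> carrier_mat n n" "P * A + A * P = A + b \<cdot>\<^sub>m (A * A)"
      and Q: "Q \<in> carrier_mat m m" "Q * D + D * Q = D + b \<cdot>\<^sub>m (D * D)"
      by (auto simp: commutator_solvable_def)
    show "commutator_solvable (n + m) b ?F"
      unfolding commutator_solvable_def
    proof (intro bexI)
      show "four_block_mat P (0\<^sub>m n m) (0\<^sub>m m n) Q \<in> carrier_mat (n + m) (n + m)"
        using P Q by auto
      show "four_block_mat P (0\<^sub>m n m) (0\<^sub>m m n) Q * ?F + ?F * four_block_mat P (0\<^sub>m n m) (0\<^sub>m m n) Q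
          = ?F + b \<cdot>\<^sub>m (?F * ?F)"
        unfolding rhs using A D P Q by (subst eq) auto
    qed
  qed
qed

lemma commutator_solvable_jordan_matrix:
  fixes n_as :: "(nat \<times> 'a :: field) list"
  shows "commutator_solvable (sum_list (map fst n_as)) b (jordan_matrix n_as) \<longleftrightarrow>
    (\<forall>(m, \<mu>) \<in> set n_as. commutator_solvable m b (jordan_block m \<mu>))"
proof (induction n_as)
  case Nil
  have "commutator_solvable 0 b (jordan_matrix ([] :: (nat \<times> 'a) list))"
    unfolding commutator_solvable_def
    by (intro bexI[of _ "0\<^sub>m 0 0"] eq_matI) (auto simp: jordan_matrix_def)
  then show ?case
    by simp
next
  case (Cons x n_as)
  obtain m \<mu> where x: "x = (m, \<mu>)"
    by (cases x)
  let ?k = "sum_list (map fst n_as)"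
  have "jordan_matrix (x # n_as)
      = four_block_mat (jordan_block m \<mu>) (0\<^sub>m m ?k) (0\<^sub>m ?k m) (jordan_matrix n_as)"
    unfolding x jordan_matrix_def by (simp add: Let_def jordan_matrix_dim[unfolded jordan_matrix_def])
  then show ?case
    using commutator_solvable_four_block[of "jordan_block m \<mu>" m "jordan_matrix n_as" ?k b] Cons.IH
    by (simp add: x)
qed

section \<open>The commutator equation for a Jordan block\<close>

lemma jordan_block_sum_right:
  fixes f :: "nat \<Rightarrow> 'a :: field"
  assumes "j < m"
  shows "(\<Sum>k<m. f k * jordan_block m \<mu> $$ (k, j)) = f j * \<mu> + (if j > 0 then f (j - 1) else 0)"
proof -
  have "(\<Sum>k<m. f k * jordan_block m \<mu> $$ (k, j))
      = (\<Sum>k<m. (if k = j then f k * \<mu> else 0) + (if Suc k = j then f k else 0))"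
    using assms by (intro sum.cong) auto
  also have "\<dots> = f j * \<mu> + (\<Sum>k<m. if Suc k = j then f k else 0)"
    using assms by (simp add: sum.distrib)
  also have "(\<Sum>k<m. if Suc k = j then f k else 0) = (if j > 0 then f (j - 1) else 0)"
    using assms by (cases j) auto
  finally show ?thesis .
qed

lemma jordan_block_sum_left:
  fixes f :: "nat \<Rightarrow> 'a :: field"
  assumes "i < m"
  shows "(\<Sum>k<m. jordan_block m \<mu> $$ (i, k) * f k) = \<mu> * f i + (if Suc i < m then f (Suc i) else 0)"
proof -
  have "(\<Sum>k<m. jordan_block m \<mu> $$ (i, k) * f k)
      = (\<Sum>k<m. (if k = i then \<mu> * f k else 0) + (if k = Suc i then f k else 0))"
    using assms by (intro sum.cong) auto
  also have "\<dots> = \<mu> * f i + (if Suc i < m then f (Suc i) else 0)"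
    using assms by (simp add: sum.distrib)
  finally show ?thesis .
qed

lemma mult_mat_entry:
  fixes A B :: "'a :: semiring_0 mat"
  assumes "A \<in> carrier_mat n n" "B \<in> carrier_mat n n" "i < n" "j < n"
  shows "(A * B) $$ (i, j) = (\<Sum>k<n. A $$ (i, k) * B $$ (k, j))"
  using assms by (simp add: scalar_prod_def atLeast0LessThan)

text \<open>
  Compare traces. On the left \<open>tr (P J) + tr (J P) = 2 tr (P J) = 0\<close>; on the right every diagonal
  entry is \<open>\<mu> + b \<mu>\<^sup>2\<close>.
\<close>

lemma jordan_block_solvable_imp:
  fixes \<mu> :: "'a :: field"
  assumes char: "CHAR('a) = 2" and sol: "commutator_solvable m b (jordan_block m \<mu>)"
  shows "even m \<or> \<mu> + b * \<mu>\<^sup>2 = 0"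
proof -
  let ?J = "jordan_block m \<mu>"
  obtain P where P: "P \<in> carrier_mat m m" "P * ?J + ?J * P = ?J + b \<cdot>\<^sub>m (?J * ?J)"
    using sol by (auto simp: commutator_solvable_def)
  have J: "?J \<in> carrier_mat m m"
    by simp
  have entry: "(\<Sum>k<m. P $$ (i, k) * ?J $$ (k, i)) + (\<Sum>k<m. ?J $$ (i, k) * P $$ (k, i)) = \<mu> + b * \<mu>\<^sup>2"
    if i: "i < m" for i
  proof -
    have "(P * ?J + ?J * P) $$ (i, i) = (?J + b \<cdot>\<^sub>m (?J * ?J)) $$ (i, i)"
      by (simp only: P(2))
    then have "(P * ?J) $$ (i, i) + (?J * P) $$ (i, i) = \<mu> + b * (?J * ?J) $$ (i, i)"
      using i P(1) by simp
    moreover have "(?J * ?J) $$ (i, i) = \<mu>\<^sup>2"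
      unfolding mult_mat_entry[OF J J i i]
      using i by (subst jordan_block_sum_right) (auto simp: power2_eq_square)
    ultimately show ?thesis
      by (simp only: mult_mat_entry[OF P(1) J i i] mult_mat_entry[OF J P(1) i i])
  qed
  have "of_nat m * (\<mu> + b * \<mu>\<^sup>2) = (\<Sum>i<m. \<mu> + b * \<mu>\<^sup>2)"
    by simp
  also have "\<dots> = (\<Sum>i<m. (\<Sum>k<m. P $$ (i, k) * ?J $$ (k, i)) + (\<Sum>k<m. ?J $$ (i, k) * P $$ (k, i)))"
    using entry by (intro sum.cong) auto
  also have "\<dots> = (\<Sum>i<m. \<Sum>k<m. P $$ (i, k) * ?J $$ (k, i)) + (\<Sum>i<m. \<Sum>k<m. ?J $$ (i, k) * P $$ (k, i))"
    by (simp only: sum.distrib)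
  also have "(\<Sum>i<m. \<Sum>k<m. ?J $$ (i, k) * P $$ (k, i)) = (\<Sum>i<m. \<Sum>k<m. P $$ (i, k) * ?J $$ (k, i))"
    by (subst sum.swap) (simp only: mult.commute)
  finally have "of_nat m * (\<mu> + b * \<mu>\<^sup>2) = 0"
    by (simp only: char_2_double[OF char])
  then show ?thesis
    using char by (auto simp: of_nat_eq_0_iff_char_dvd)
qed

text \<open>
  Write \<open>J = \<mu> + N\<close> and \<open>c = \<mu> + b \<mu>\<^sup>2\<close>. In characteristic \<open>2\<close> the scalar \<open>\<mu>\<close> drops out of the left
  side, so \<open>P N + N P = c + N + b N\<^sup>2\<close> has to be solved. A diagonal of \<open>P\<close> with entries \<open>0, 1, 0, 1, \<dots>\<close>
  produces \<open>N\<close>, since consecutive entries sum to \<open>1\<close>. In the same way a superdiagonal with entries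
  \<open>0, b, 0, b, \<dots>\<close> produces \<open>b N\<^sup>2\<close>, and a subdiagonal with entries \<open>c, 0, c, 0, \<dots>\<close> produces \<open>c\<close>.
  The three are combined in row \<open>i\<close> with the factor \<open>i\<close>. Only the last diagonal entry is at risk: it
  lacks the contribution of a row \<open>m\<close>, which would be \<open>m c\<close>, and \<open>m c = 0\<close> by assumption.
\<close>

lemma jordan_block_solvable:
  fixes \<mu> :: "'a :: field"
  assumes char: "CHAR('a) = 2" and ok: "even m \<or> \<mu> + b * \<mu>\<^sup>2 = 0"
  shows "commutator_solvable m b (jordan_block m \<mu>)"
proof -
  let ?J = "jordan_block m \<mu>"
  have J: "?J \<in> carrier_mat m m"
    by simp
  define c where "c = \<mu> + b * \<mu>\<^sup>2"
  define e :: "nat \<Rightarrow> nat \<Rightarrow> 'a" where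
    "e i j = (if j = i then 1 else if j = Suc i then b else if i = Suc j then c else 0)" for i j
  define p where "p i j = of_nat i * e i j" for i j
  define P where "P = mat m m (\<lambda>(i, j). p i j)"
  have P: "P \<in> carrier_mat m m"
    by (simp add: P_def)
  have x2: "x + x = 0" for x :: 'a
    using char_2_double[OF char] .
  have m0: "of_nat m * c = 0"
    using ok char unfolding c_def of_nat_eq_0_iff_char_dvd[symmetric] by (auto simp: of_nat_eq_0_iff_char_dvd)
  have main: "(if j > 0 then p i (j - 1) else 0) + (if Suc i < m then p (Suc i) j else 0)
      = (if j = i then c else if j = Suc i then 1 else if j = Suc (Suc i) then b else 0)"
    if ij: "i < m" "j < m" for i j
  proof -
    have last: "p (Suc i) j = 0" if "\<not> Suc i < m"
    proof -
      have "Suc i = m"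
        using that ij by simp
      then show ?thesis
        using m0 ij by (auto simp: p_def e_def)
    qed
    then have drop: "(if Suc i < m then p (Suc i) j else 0) = p (Suc i) j"
      by simp
    have first: "(if j > 0 then p i (j - 1) else 0) = of_nat i * (if j = Suc i then 1 else if j = Suc (Suc i) then b else if j = i then c else 0)"
      by (cases j) (auto simp: p_def e_def)
    have second: "p (Suc i) j = of_nat (Suc i) * (if j = Suc i then 1 else if j = Suc (Suc i) then b else if j = i then c else 0)"
      by (simp add: p_def e_def)
    have cancel: "of_nat i * y + of_nat (Suc i) * y = y" for y :: 'a
      using x2[of "of_nat i * y"] by (simp add: algebra_simps)
    show ?thesis
      unfolding first drop unfolding second cancel by auto
  qed
  show ?thesis
    unfolding commutator_solvable_def
  proof (intro bexI[OF _ P] eq_matI)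
    fix i j
    assume "i < dim_row (?J + b \<cdot>\<^sub>m (?J * ?J))" "j < dim_col (?J + b \<cdot>\<^sub>m (?J * ?J))"
    then have ij: "i < m" "j < m"
      by simp_all
    have "(P * ?J + ?J * P) $$ (i, j) = (P * ?J) $$ (i, j) + (?J * P) $$ (i, j)"
      using ij P by simp
    also have "(P * ?J) $$ (i, j) = p i j * \<mu> + (if j > 0 then p i (j - 1) else 0)"
      unfolding mult_mat_entry[OF P J ij] using ij
      by (subst jordan_block_sum_right) (auto simp: P_def)
    also have "(?J * P) $$ (i, j) = \<mu> * p i j + (if Suc i < m then p (Suc i) j else 0)"
      unfolding mult_mat_entry[OF J P ij] using ij
      by (subst jordan_block_sum_left) (auto simp: P_def)
    also have "p i j * \<mu> + (if j > 0 then p i (j - 1) else 0) + (\<mu> * p i j + (if Suc i < m then p (Suc i) j else 0))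
        = (p i j * \<mu> + p i j * \<mu>) + ((if j > 0 then p i (j - 1) else 0) + (if Suc i < m then p (Suc i) j else 0))"
      by (simp only: ac_simps)
    also have "\<dots> = (if j = i then c else if j = Suc i then 1 else if j = Suc (Suc i) then b else 0)"
      unfolding main[OF ij] x2 by simp
    also have "\<dots> = (?J + b \<cdot>\<^sub>m (?J * ?J)) $$ (i, j)"
    proof -
      have "(?J * ?J) $$ (i, j) = ?J $$ (i, j) * \<mu> + (if j > 0 then ?J $$ (i, j - 1) else 0)"
        unfolding mult_mat_entry[OF J J ij] using ij(2) by (rule jordan_block_sum_right)
      also have "\<dots> = (if j = i then \<mu>\<^sup>2 else if j = Suc i then \<mu> + \<mu> else if j = Suc (Suc i) then 1 else 0)"
        using ij by (cases j) (auto simp: power2_eq_square)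
      finally show ?thesis
        using ij by (simp add: c_def x2)
    qed
    finally show "(P * ?J + ?J * P) $$ (i, j) = (?J + b \<cdot>\<^sub>m (?J * ?J)) $$ (i, j)" .
  qed (use P in auto)
qed

section \<open>Composites and idempotent solutions\<close>

text \<open>
  If \<open>A = \<alpha> (P + Q)\<close> with idempotents \<open>P\<close> and \<open>Q\<close>, then both \<open>P A + A P\<close> and \<open>A + A\<^sup>2 / \<alpha>\<close> equal
  \<open>\<alpha> (P Q + Q P)\<close>. Conversely \<open>Q = P + A / \<alpha>\<close> satisfies
  \<open>Q\<^sup>2 = P + (P A + A P) / \<alpha> + A\<^sup>2 / \<alpha>\<^sup>2\<close>, and the equation turns this into \<open>Q\<close>.
\<close>

lemma composite_iff_idempotent_solution:
  fixes A :: "'a :: field mat"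
  assumes char: "CHAR('a) = 2" and \<alpha>: "\<alpha> \<noteq> 0" and A: "A \<in> carrier_mat n n"
  shows "composite_mat n \<alpha> (- \<alpha>) A \<longleftrightarrow>
    (\<exists>P \<in> carrier_mat n n. P * P = P \<and> P * A + A * P = A + inverse \<alpha> \<cdot>\<^sub>m (A * A))"
proof
  have x2: "x + x = 0" for x :: 'a
    using char_2_double[OF char] .
  then have neg: "- x = x" for x :: 'a
    by (metis minus_unique)
  {
    assume "composite_mat n \<alpha> (- \<alpha>) A"
    then obtain P Q where P: "P \<in> carrier_mat n n" "P * P = P" and Q: "Q \<in> carrier_mat n n" "Q * Q = Q"
      and A_eq: "A = \<alpha> \<cdot>\<^sub>m P + \<alpha> \<cdot>\<^sub>m Q"
      by (auto simp: composite_mat_def neg)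
    have PA: "P * A = \<alpha> \<cdot>\<^sub>m P + \<alpha> \<cdot>\<^sub>m (P * Q)"
      unfolding A_eq using P Q
      by (simp add: mult_add_distrib_mat[of _ n n _ n] mult_smult_distrib[of _ n n _ n])
    have AP: "A * P = \<alpha> \<cdot>\<^sub>m P + \<alpha> \<cdot>\<^sub>m (Q * P)"
      unfolding A_eq using P Q
      by (simp add: add_mult_distrib_mat[of _ n n _ _ n] mult_smult_assoc_mat[of _ n n _ n])
    have AQ: "A * Q = \<alpha> \<cdot>\<^sub>m (P * Q) + \<alpha> \<cdot>\<^sub>m Q"
      unfolding A_eq using P Q
      by (simp add: add_mult_distrib_mat[of _ n n _ _ n] mult_smult_assoc_mat[of _ n n _ n])
    have "A * A = A * (\<alpha> \<cdot>\<^sub>m P + \<alpha> \<cdot>\<^sub>m Q)"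
      by (simp flip: A_eq)
    also have "\<dots> = \<alpha> \<cdot>\<^sub>m (A * P) + \<alpha> \<cdot>\<^sub>m (A * Q)"
      using A P Q by (simp add: mult_add_distrib_mat[of _ n n _ n] mult_smult_distrib[of _ n n _ n])
    finally have AA: "A * A = \<alpha> \<cdot>\<^sub>m (\<alpha> \<cdot>\<^sub>m P + \<alpha> \<cdot>\<^sub>m (Q * P)) + \<alpha> \<cdot>\<^sub>m (\<alpha> \<cdot>\<^sub>m (P * Q) + \<alpha> \<cdot>\<^sub>m Q)"
      by (simp only: AP AQ)
    define U W where "U = P * Q" and "W = Q * P"
    have UW: "U \<in> carrier_mat n n" "W \<in> carrier_mat n n"
      using P Q by (auto simp: U_def W_def)
    have "P * A + A * P = A + inverse \<alpha> \<cdot>\<^sub>m (A * A)"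
      unfolding AA unfolding PA AP unfolding U_def[symmetric] W_def[symmetric] unfolding A_eq
    proof (rule eq_matI)
      fix i j
      assume "i < dim_row (\<alpha> \<cdot>\<^sub>m P + \<alpha> \<cdot>\<^sub>m Q + inverse \<alpha> \<cdot>\<^sub>m
          (\<alpha> \<cdot>\<^sub>m (\<alpha> \<cdot>\<^sub>m P + \<alpha> \<cdot>\<^sub>m W) + \<alpha> \<cdot>\<^sub>m (\<alpha> \<cdot>\<^sub>m U + \<alpha> \<cdot>\<^sub>m Q)))"
        and "j < dim_col (\<alpha> \<cdot>\<^sub>m P + \<alpha> \<cdot>\<^sub>m Q + inverse \<alpha> \<cdot>\<^sub>m
          (\<alpha> \<cdot>\<^sub>m (\<alpha> \<cdot>\<^sub>m P + \<alpha> \<cdot>\<^sub>m W) + \<alpha> \<cdot>\<^sub>m (\<alpha> \<cdot>\<^sub>m U + \<alpha> \<cdot>\<^sub>m Q)))"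
      then have ij: "i < n" "j < n"
        using Q by auto
      have cancel: "inverse \<alpha> * (\<alpha> * x + \<alpha> * y) = x + y" for x y
        using \<alpha> by (simp add: field_simps)
      let ?p = "P $$ (i, j)" and ?q = "Q $$ (i, j)" and ?u = "U $$ (i, j)" and ?w = "W $$ (i, j)"
      have "(\<alpha> \<cdot>\<^sub>m P + \<alpha> \<cdot>\<^sub>m Q + inverse \<alpha> \<cdot>\<^sub>m
          (\<alpha> \<cdot>\<^sub>m (\<alpha> \<cdot>\<^sub>m P + \<alpha> \<cdot>\<^sub>m W) + \<alpha> \<cdot>\<^sub>m (\<alpha> \<cdot>\<^sub>m U + \<alpha> \<cdot>\<^sub>m Q))) $$ (i, j)
        = \<alpha> * ?p + \<alpha> * ?q + inverse \<alpha> * (\<alpha> * (\<alpha> * ?p + \<alpha> * ?w) + \<alpha> * (\<alpha> * ?u + \<alpha> * ?q))"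
        using ij P Q UW by simp
      also have "\<dots> = (\<alpha> * ?p + \<alpha> * ?u + (\<alpha> * ?p + \<alpha> * ?w)) + (\<alpha> * ?q + \<alpha> * ?q)"
        by (simp only: cancel add_ac)
      also have "\<dots> = (\<alpha> \<cdot>\<^sub>m P + \<alpha> \<cdot>\<^sub>m U + (\<alpha> \<cdot>\<^sub>m P + \<alpha> \<cdot>\<^sub>m W)) $$ (i, j)"
        using ij P Q UW by (simp add: x2)
      finally show "(\<alpha> \<cdot>\<^sub>m P + \<alpha> \<cdot>\<^sub>m U + (\<alpha> \<cdot>\<^sub>m P + \<alpha> \<cdot>\<^sub>m W)) $$ (i, j)
        = (\<alpha> \<cdot>\<^sub>m P + \<alpha> \<cdot>\<^sub>m Q + inverse \<alpha> \<cdot>\<^sub>m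
          (\<alpha> \<cdot>\<^sub>m (\<alpha> \<cdot>\<^sub>m P + \<alpha> \<cdot>\<^sub>m W) + \<alpha> \<cdot>\<^sub>m (\<alpha> \<cdot>\<^sub>m U + \<alpha> \<cdot>\<^sub>m Q))) $$ (i, j)"
        ..
    qed (use P Q UW in auto)
    with P show "\<exists>P \<in> carrier_mat n n. P * P = P \<and> P * A + A * P = A + inverse \<alpha> \<cdot>\<^sub>m (A * A)"
      by blast
  next
    assume "\<exists>P \<in> carrier_mat n n. P * P = P \<and> P * A + A * P = A + inverse \<alpha> \<cdot>\<^sub>m (A * A)"
    then obtain P where P: "P \<in> carrier_mat n n" "P * P = P"
      and sol: "P * A + A * P = A + inverse \<alpha> \<cdot>\<^sub>m (A * A)"
      by blast
    define b where "b = inverse \<alpha>"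
    define Q where "Q = P + b \<cdot>\<^sub>m A"
    have Q: "Q \<in> carrier_mat n n"
      using P A by (simp add: Q_def)
    have QP: "Q * P = P + b \<cdot>\<^sub>m (A * P)"
      unfolding Q_def using P A
      by (simp add: add_mult_distrib_mat[of _ n n _ _ n] mult_smult_assoc_mat[of _ n n _ n])
    have QA: "Q * A = P * A + b \<cdot>\<^sub>m (A * A)"
      unfolding Q_def using P A
      by (simp add: add_mult_distrib_mat[of _ n n _ _ n] mult_smult_assoc_mat[of _ n n _ n])
    have "Q * Q = Q * (P + b \<cdot>\<^sub>m A)"
      by (simp add: Q_def)
    also have "\<dots> = Q * P + b \<cdot>\<^sub>m (Q * A)"
      using A P Q by (simp add: mult_add_distrib_mat[of _ n n _ n] mult_smult_distrib[of _ n n _ n])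
    finally have QQ: "Q * Q = (P + b \<cdot>\<^sub>m (A * P)) + b \<cdot>\<^sub>m (P * A + b \<cdot>\<^sub>m (A * A))"
      by (simp only: QP QA)
    define U W Y where "U = P * A" and "W = A * P" and "Y = A * A"
    have UWY: "U \<in> carrier_mat n n" "W \<in> carrier_mat n n" "Y \<in> carrier_mat n n"
      using P A by (auto simp: U_def W_def Y_def)
    have sol': "U + W = A + b \<cdot>\<^sub>m Y"
      using sol by (simp add: U_def W_def Y_def b_def)
    have "Q * Q = Q"
      unfolding QQ U_def[symmetric] W_def[symmetric] Y_def[symmetric]
    proof (rule eq_matI)
      fix i j
      assume "i < dim_row Q" "j < dim_col Q"
      then have ij: "i < n" "j < n"
        using Q by auto
      have "(U + W) $$ (i, j) = (A + b \<cdot>\<^sub>m Y) $$ (i, j)"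
        by (simp only: sol')
      then have "U $$ (i, j) + W $$ (i, j) = A $$ (i, j) + b * Y $$ (i, j)"
        using ij UWY A by simp
      then have W_entry: "W $$ (i, j) = A $$ (i, j) + b * Y $$ (i, j) - U $$ (i, j)"
        by (simp add: algebra_simps)
      have "(P + b \<cdot>\<^sub>m W + b \<cdot>\<^sub>m (U + b \<cdot>\<^sub>m Y)) $$ (i, j)
        = P $$ (i, j) + b * W $$ (i, j) + b * (U $$ (i, j) + b * Y $$ (i, j))"
        using ij UWY A P by simp
      also have "\<dots> = P $$ (i, j) + b * A $$ (i, j) + (b * (b * Y $$ (i, j)) + b * (b * Y $$ (i, j)))"
        unfolding W_entry by (simp add: algebra_simps)
      also have "\<dots> = Q $$ (i, j)"
        using ij P A by (simp only: x2) (simp add: Q_def)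
      finally show "(P + b \<cdot>\<^sub>m W + b \<cdot>\<^sub>m (U + b \<cdot>\<^sub>m Y)) $$ (i, j) = Q $$ (i, j)" .
    qed (use P Q UWY A in auto)
    moreover have "A = \<alpha> \<cdot>\<^sub>m P + (- \<alpha>) \<cdot>\<^sub>m Q"
    proof (rule eq_matI)
      fix i j
      assume "i < dim_row (\<alpha> \<cdot>\<^sub>m P + (- \<alpha>) \<cdot>\<^sub>m Q)" "j < dim_col (\<alpha> \<cdot>\<^sub>m P + (- \<alpha>) \<cdot>\<^sub>m Q)"
      then have ij: "i < n" "j < n"
        using Q by auto
      have "(\<alpha> \<cdot>\<^sub>m P + (- \<alpha>) \<cdot>\<^sub>m Q) $$ (i, j) = - (\<alpha> * b * A $$ (i, j))"
        using ij P A by (simp add: Q_def algebra_simps)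
      also have "\<dots> = A $$ (i, j)"
        by (simp only: neg b_def right_inverse[OF \<alpha>] mult_1_left)
      finally show "A $$ (i, j) = (\<alpha> \<cdot>\<^sub>m P + (- \<alpha>) \<cdot>\<^sub>m Q) $$ (i, j)" ..
    qed (use A Q in auto)
    ultimately show "composite_mat n \<alpha> (- \<alpha>) A"
      unfolding composite_mat_def using P Q by blast
  }
qed

section \<open>Transfer between matrices and operators\<close>

text \<open>
  To use the results on linear operators, vectors of length \<open>n\<close> are represented as functions on all
  of the natural numbers that vanish from \<open>n\<close> on. They then live in a type that is an additive
  group and does not depend on \<open>n\<close>.
\<close>

definition mat_apply :: "nat \<Rightarrow> 'a :: field mat \<Rightarrow> (nat \<Rightarrow> 'a) \<Rightarrow> nat \<Rightarrow> 'a" where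
  "mat_apply n A v = (\<lambda>i. if i < n then (\<Sum>j<n. A $$ (i, j) * v j) else 0)"

definition coord_space :: "nat \<Rightarrow> (nat \<Rightarrow> 'a :: field) set" where
  "coord_space n = {v. \<forall>i\<ge>n. v i = 0}"

definition unit_fun :: "nat \<Rightarrow> nat \<Rightarrow> 'a :: field" where
  "unit_fun j = (\<lambda>i. if i = j then 1 else 0)"

lemma mat_apply_in: "mat_apply n A v \<in> coord_space n"
  by (simp add: mat_apply_def coord_space_def)

lemma unit_fun_in: "j < n \<Longrightarrow> unit_fun j \<in> coord_space n"
  by (simp add: unit_fun_def coord_space_def)

lemma mat_apply_add_right: "mat_apply n A (u + v) = mat_apply n A u + mat_apply n A v"
  by (simp add: mat_apply_def fun_eq_iff sum.distrib algebra_simps)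

lemma mat_apply_scale_right: "mat_apply n A (\<lambda>i. c * v i) = (\<lambda>i. c * mat_apply n A v i)"
  by (simp add: mat_apply_def fun_eq_iff sum_distrib_left mult_ac)

lemma mat_apply_add:
  assumes "A \<in> carrier_mat n n" "B \<in> carrier_mat n n"
  shows "mat_apply n (A + B) v = mat_apply n A v + mat_apply n B v"
  using assms by (simp add: mat_apply_def fun_eq_iff sum.distrib algebra_simps)

lemma mat_apply_smult:
  assumes "A \<in> carrier_mat n n"
  shows "mat_apply n (c \<cdot>\<^sub>m A) v = (\<lambda>i. c * mat_apply n A v i)"
  using assms by (simp add: mat_apply_def fun_eq_iff sum_distrib_left mult_ac)

lemma mat_apply_mult:
  assumes "A \<in> carrier_mat n n" "B \<in> carrier_mat n n"
  shows "mat_apply n (A * B) v = mat_apply n A (mat_apply n B v)"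
proof (rule ext)
  fix i
  show "mat_apply n (A * B) v i = mat_apply n A (mat_apply n B v) i"
  proof (cases "i < n")
    case True
    have "(\<Sum>j<n. (A * B) $$ (i, j) * v j) = (\<Sum>j<n. \<Sum>k<n. A $$ (i, k) * B $$ (k, j) * v j)"
      using mult_mat_entry[OF assms True] by (simp add: sum_distrib_right)
    also have "\<dots> = (\<Sum>k<n. \<Sum>j<n. A $$ (i, k) * (B $$ (k, j) * v j))"
      by (subst sum.swap) (simp only: mult.assoc)
    also have "\<dots> = (\<Sum>k<n. A $$ (i, k) * (\<Sum>j<n. B $$ (k, j) * v j))"
      by (simp only: sum_distrib_left)
    finally show ?thesis
      using True by (simp add: mat_apply_def)
  qed (simp add: mat_apply_def)
qed

lemma mat_apply_unit_fun: "i < n \<Longrightarrow> j < n \<Longrightarrow> mat_apply n A (unit_fun j) i = A $$ (i, j)"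
  by (simp add: mat_apply_def unit_fun_def if_distrib cong: if_cong)

lemma mat_apply_inj:
  assumes "A \<in> carrier_mat n n" "B \<in> carrier_mat n n"
    and "\<And>v. v \<in> coord_space n \<Longrightarrow> mat_apply n A v = mat_apply n B v"
  shows "A = B"
proof (rule eq_matI)
  fix i j
  assume "i < dim_row B" "j < dim_col B"
  then have ij: "i < n" "j < n"
    using assms(2) by auto
  then show "A $$ (i, j) = B $$ (i, j)"
    using assms(3)[OF unit_fun_in[OF ij(2)]] mat_apply_unit_fun[OF ij] by metis
qed (use assms in auto)

lemma coord_space_induct [consumes 1, case_names zero step]:
  assumes v: "v \<in> coord_space n" and zero: "P 0"
    and step: "\<And>u c j. j < n \<Longrightarrow> u \<in> coord_space n \<Longrightarrow> P u \<Longrightarrow> P (u + (\<lambda>i. c * unit_fun j i))"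
  shows "P v"
proof -
  let ?t = "\<lambda>k i. if i < k then v i else 0"
  have "k \<le> n \<Longrightarrow> P (?t k)" for k
  proof (induction k)
    case 0
    then show ?case
      using zero by (simp add: zero_fun_def)
  next
    case (Suc k)
    have "?t k \<in> coord_space n"
      using Suc.prems by (auto simp: coord_space_def)
    then have "P (?t k + (\<lambda>i. v k * unit_fun k i))"
      using Suc step[of k "?t k" "v k"] by simp
    moreover have "?t k + (\<lambda>i. v k * unit_fun k i) = ?t (Suc k)"
      by (auto simp: fun_eq_iff unit_fun_def less_Suc_eq)
    ultimately show ?case
      by simp
  qed
  from this[of n] have "P (?t n)"
    by simp
  moreover have "?t n = v"
    using v by (auto simp: fun_eq_iff coord_space_def not_less)
  ultimately show ?thesis
    by simp
qed

text \<open>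
  The operator version gives an idempotent solution that is linear on the coordinate space; it is
  turned back into the matrix \<open>M\<close> of its values at the unit vectors.
\<close>

lemma idempotent_solution:
  fixes A :: "'a :: field mat"
  assumes char: "CHAR('a) = 2" and A: "A \<in> carrier_mat n n" and sol: "commutator_solvable n b A"
  shows "\<exists>P \<in> carrier_mat n n. P * P = P \<and> P * A + A * P = A + b \<cdot>\<^sub>m (A * A)"
proof -
  let ?V = "coord_space n :: (nat \<Rightarrow> 'a) set"
  interpret V: char_2_operator "\<lambda>c (v :: nat \<Rightarrow> 'a) i. c * v i" "mat_apply n A"
    by unfold_locales
       (simp_all add: fun_eq_iff algebra_simps char mat_apply_add_right mat_apply_scale_right)
  have sub: "V.subspace ?V"
    by (auto simp: V.subspace_def coord_space_def)
  then have inv: "V.invariant_subspace ?V"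
    by (simp add: V.invariant_subspace_def mat_apply_in)
  have "?V \<subseteq> V.span (unit_fun ` {..<n})"
  proof
    fix v :: "nat \<Rightarrow> 'a"
    assume "v \<in> ?V"
    then show "v \<in> V.span (unit_fun ` {..<n})"
    proof (induction rule: coord_space_induct)
      case zero
      show ?case
        by (rule V.span_zero)
    next
      case (step u c j)
      then show ?case
        by (intro V.span_add[OF step(3)] V.span_scale V.span_base) auto
    qed
  qed
  then have fin: "V.dim_at_most n ?V"
    unfolding V.dim_at_most_def
    using V.independent_span_bound[of "unit_fun ` {..<n}"] card_image_le[of "{..<n}" "unit_fun :: nat \<Rightarrow> nat \<Rightarrow> 'a"]
    by (metis card_lessThan dual_order.trans finite_imageI finite_lessThan)
  obtain P where P: "P \<in> carrier_mat n n" "P * A + A * P = A + b \<cdot>\<^sub>m (A * A)"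
    using sol by (auto simp: commutator_solvable_def)
  have comm: "mat_apply n (M * A + A * M) v = mat_apply n M (mat_apply n A v) + mat_apply n A (mat_apply n M v)"
    if "M \<in> carrier_mat n n" for M v
    using that A by (simp add: mat_apply_add[of _ n] mat_apply_mult)
  have rhs: "mat_apply n (A + b \<cdot>\<^sub>m (A * A)) v = mat_apply n A v + (\<lambda>i. b * mat_apply n A (mat_apply n A v) i)" for v
    using A by (simp add: mat_apply_add[of _ n] mat_apply_mult mat_apply_smult[of _ n])
  have "V.solves_on b ?V (mat_apply n P)"
    using comm[OF P(1)] rhs unfolding P(2)
    by (simp add: V.solves_on_def V.lin_on_def mat_apply_in mat_apply_add_right mat_apply_scale_right)
  from V.ex_idempotent_solution[OF inv fin this] obtain R
    where R: "V.solves_on b ?V R" "\<forall>v\<in>?V. R (R v) = R v"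
    by blast
  have R_in: "v \<in> ?V \<Longrightarrow> R v \<in> ?V" and R_add: "u \<in> ?V \<Longrightarrow> v \<in> ?V \<Longrightarrow> R (u + v) = R u + R v"
    and R_scale: "v \<in> ?V \<Longrightarrow> R (\<lambda>i. c * v i) = (\<lambda>i. c * R v i)"
    and R_eq: "v \<in> ?V \<Longrightarrow> R (mat_apply n A v) + mat_apply n A (R v)
      = mat_apply n A v + (\<lambda>i. b * mat_apply n A (mat_apply n A v) i)" for u v c
    using R(1) unfolding V.solves_on_def V.lin_on_def by blast+
  define M where "M = mat n n (\<lambda>(i, j). R (unit_fun j) i)"
  have M: "M \<in> carrier_mat n n"
    by (simp add: M_def)
  have R_M: "R v = mat_apply n M v" if "v \<in> ?V" for v
    using that
  proof (induction rule: coord_space_induct)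
    case zero
    have "0 \<in> ?V"
      by (simp add: coord_space_def)
    from R_scale[OF this, of 0] show ?case
      by (simp add: mat_apply_def fun_eq_iff zero_fun_def)
  next
    case (step u c j)
    have unit: "unit_fun j \<in> ?V"
      using step by (simp add: unit_fun_in)
    then have "(\<lambda>i. c * unit_fun j i) \<in> ?V"
      by (simp add: coord_space_def)
    then have "R (u + (\<lambda>i. c * unit_fun j i)) = R u + (\<lambda>i. c * R (unit_fun j) i)"
      using R_add R_scale[OF unit] step by simp
    moreover have "R (unit_fun j) = mat_apply n M (unit_fun j)"
    proof (rule ext)
      fix i
      show "R (unit_fun j) i = mat_apply n M (unit_fun j) i"
      proof (cases "i < n")
        case True
        then show ?thesis
          using step by (simp add: mat_apply_unit_fun M_def)
      next
        case False
        then show ?thesis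
          using R_in[OF unit] by (simp add: coord_space_def mat_apply_def)
      qed
    qed
    ultimately show ?case
      using step(3) by (simp only: mat_apply_add_right mat_apply_scale_right)
  qed
  have "M * M = M"
  proof (rule mat_apply_inj)
    fix v :: "nat \<Rightarrow> 'a"
    assume "v \<in> ?V"
    then show "mat_apply n (M * M) v = mat_apply n M v"
      using R(2) R_in by (simp add: mat_apply_mult[OF M M] flip: R_M)
  qed (use M in auto)
  moreover have "M * A + A * M = A + b \<cdot>\<^sub>m (A * A)"
  proof (rule mat_apply_inj)
    fix v :: "nat \<Rightarrow> 'a"
    assume v: "v \<in> ?V"
    show "mat_apply n (M * A + A * M) v = mat_apply n (A + b \<cdot>\<^sub>m (A * A)) v"
      unfolding comm[OF M] rhs using R_eq[OF v] by (simp only: R_M[OF v] R_M[OF mat_apply_in])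
  qed (use M A in auto)
  ultimately show ?thesis
    using M by blast
qed

section \<open>Change of the base field\<close>

text \<open>
  Apply a \<open>K\<close>-linear map \<open>\<phi>\<close> from the algebraic closure to \<open>K\<close> with \<open>\<phi> 1 = 1\<close> to the entries of a
  solution. It is compatible with multiplication by the entries of \<open>A\<close> and fixes the right side, as
  these have entries in \<open>K\<close>.
\<close>

lemma commutator_solvable_descent:
  fixes A :: "'k :: field mat"
  assumes A: "A \<in> carrier_mat n n"
    and sol: "commutator_solvable n (to_ac b) (map_mat to_ac A)"
  shows "commutator_solvable n b A"
proof -
  interpret V: vector_space "\<lambda>(c :: 'k) (x :: 'k alg_closure). to_ac c * x"
    by unfold_locales (simp_all add: algebra_simps)
  have "V.independent {1}"
    by (simp add: V.dependent_single)
  then obtain \<phi> :: "'k alg_closure \<Rightarrow> 'k" where add: "\<And>x y. \<phi> (x + y) = \<phi> x + \<phi> y"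
    and scale: "\<And>c x. \<phi> (to_ac c * x) = c * \<phi> x" and one: "\<And>x. x \<in> {1} \<Longrightarrow> \<phi> x = 1"
    by (rule V.ex_functional_extending[where g = "\<lambda>_. 1"]) blast
  have \<phi>_to_ac: "\<phi> (to_ac c) = c" for c
    using scale[of c 1] one[of 1] by simp
  have \<phi>_0: "\<phi> 0 = 0"
    using scale[of 0 0] by simp
  have \<phi>_sum: "\<phi> (sum h I) = (\<Sum>i\<in>I. \<phi> (h i))" for h and I :: "nat set"
    by (induction I rule: infinite_finite_induct) (simp_all add: \<phi>_0 add)
  let ?A = "map_mat to_ac A"
  obtain P where P: "P \<in> carrier_mat n n" "P * ?A + ?A * P = ?A + to_ac b \<cdot>\<^sub>m (?A * ?A)"
    using sol by (auto simp: commutator_solvable_def)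
  let ?P = "map_mat \<phi> P"
  have A': "?A \<in> carrier_mat n n" and P': "?P \<in> carrier_mat n n"
    using A P by auto
  have "?P * A + A * ?P = A + b \<cdot>\<^sub>m (A * A)"
  proof (rule eq_matI)
    fix i j
    assume "i < dim_row (A + b \<cdot>\<^sub>m (A * A))" "j < dim_col (A + b \<cdot>\<^sub>m (A * A))"
    then have ij: "i < n" "j < n"
      using A by auto
    have "\<phi> ((P * ?A + ?A * P) $$ (i, j)) = \<phi> ((?A + to_ac b \<cdot>\<^sub>m (?A * ?A)) $$ (i, j))"
      by (simp only: P(2))
    moreover have "(P * ?A + ?A * P) $$ (i, j) = (\<Sum>k<n. to_ac (A $$ (k, j)) * P $$ (i, k))
        + (\<Sum>k<n. to_ac (A $$ (i, k)) * P $$ (k, j))"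
    proof -
      have "(P * ?A + ?A * P) $$ (i, j) = (P * ?A) $$ (i, j) + (?A * P) $$ (i, j)"
        using ij P(1) A by (simp del: index_mult_mat(1))
      then show ?thesis
        unfolding mult_mat_entry[OF P(1) A' ij] mult_mat_entry[OF A' P(1) ij]
        using A ij by (simp add: mult.commute)
    qed
    then have "\<phi> ((P * ?A + ?A * P) $$ (i, j))
        = (\<Sum>k<n. A $$ (k, j) * \<phi> (P $$ (i, k))) + (\<Sum>k<n. A $$ (i, k) * \<phi> (P $$ (k, j)))"
      by (simp add: add \<phi>_sum scale)
    moreover have "(?P * A + A * ?P) $$ (i, j)
        = (\<Sum>k<n. A $$ (k, j) * \<phi> (P $$ (i, k))) + (\<Sum>k<n. A $$ (i, k) * \<phi> (P $$ (k, j)))"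
    proof -
      have "(?P * A + A * ?P) $$ (i, j) = (?P * A) $$ (i, j) + (A * ?P) $$ (i, j)"
        using ij P(1) A by (simp del: index_mult_mat(1))
      then show ?thesis
        unfolding mult_mat_entry[OF P' A ij] mult_mat_entry[OF A P' ij]
        using P ij by (simp add: mult.commute)
    qed
    moreover have "(?A + to_ac b \<cdot>\<^sub>m (?A * ?A)) $$ (i, j) = to_ac ((A + b \<cdot>\<^sub>m (A * A)) $$ (i, j))"
    proof -
      have "(?A * ?A) $$ (i, j) = to_ac ((A * A) $$ (i, j))"
        unfolding mult_mat_entry[OF A' A' ij] mult_mat_entry[OF A A ij]
        using A ij by (simp add: to_ac_sum)
      then show ?thesis
        using A ij by (simp del: index_mult_mat(1))
    qed
    ultimately show "(?P * A + A * ?P) $$ (i, j) = (A + b \<cdot>\<^sub>m (A * A)) $$ (i, j)"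
      by (simp only: \<phi>_to_ac)
  qed (use A P in auto)
  then show ?thesis
    using P' by (auto simp: commutator_solvable_def)
qed

lemma commutator_solvable_map:
  fixes A :: "'k :: field mat"
  assumes A: "A \<in> carrier_mat n n" and sol: "commutator_solvable n b A"
  shows "commutator_solvable n (to_ac b) (map_mat to_ac A)"
proof -
  interpret semiring_hom "to_ac :: 'k \<Rightarrow> 'k alg_closure"
    by unfold_locales simp_all
  obtain P where P: "P \<in> carrier_mat n n" "P * A + A * P = A + b \<cdot>\<^sub>m (A * A)"
    using sol by (auto simp: commutator_solvable_def)
  have hom_add: "map_mat to_ac (M + N) = map_mat to_ac M + map_mat to_ac N"
    if "M \<in> carrier_mat n n" "N \<in> carrier_mat n n" for M N :: "'k mat"
    using that by (intro eq_matI) auto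
  have hom_smult: "map_mat to_ac (c \<cdot>\<^sub>m M) = to_ac c \<cdot>\<^sub>m map_mat to_ac M" for c and M :: "'k mat"
    by (intro eq_matI) auto
  have "map_mat to_ac (P * A + A * P) = map_mat to_ac (A + b \<cdot>\<^sub>m (A * A))"
    by (simp only: P(2))
  then have "map_mat to_ac P * map_mat to_ac A + map_mat to_ac A * map_mat to_ac P
      = map_mat to_ac A + to_ac b \<cdot>\<^sub>m (map_mat to_ac A * map_mat to_ac A)"
    using A P(1)
    by (simp add: hom_add hom_smult mat_hom_mult[of _ n n _ n])
  then show ?thesis
    using P(1) by (auto simp: commutator_solvable_def)
qed

section \<open>The characterisation of composites\<close>

theorem theorem5:
  fixes \<alpha> :: "'k :: field" and n :: nat and A :: "'k mat"
  assumes "CHAR('k) = 2" and "\<alpha> \<noteq> 0" and "n \<ge> 1" and "A \<in> carrier_mat n n"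
  shows "composite_mat n \<alpha> (- \<alpha>) A \<longleftrightarrow>
    (\<forall>\<mu> :: 'k alg_closure. \<mu> \<notin> {0, to_ac \<alpha>} \<longrightarrow>
       (\<forall>m. has_jordan_block (map_mat to_ac A) m \<mu> \<longrightarrow> even m))"
proof -
  note A = assms(4)
  let ?A = "map_mat to_ac A"
  define b where "b = inverse \<alpha>"
  have char: "CHAR('k alg_closure) = 2"
    using assms(1) by (simp add: CHAR_alg_closure)
  have A': "?A \<in> carrier_mat n n"
    using A by simp
  have exceptional: "\<mu> + to_ac b * \<mu>\<^sup>2 = 0 \<longleftrightarrow> \<mu> \<in> {0, to_ac \<alpha>}" for \<mu> :: "'k alg_closure"
  proof -
    have ba: "to_ac b * to_ac \<alpha> = 1"
      using assms(2) by (simp add: b_def)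
    have "to_ac b * (\<mu> * (to_ac \<alpha> + \<mu>)) = (to_ac b * to_ac \<alpha>) * \<mu> + to_ac b * \<mu>\<^sup>2"
      by (simp only: power2_eq_square ring_distribs mult_ac)
    then have "\<mu> + to_ac b * \<mu>\<^sup>2 = to_ac b * (\<mu> * (to_ac \<alpha> + \<mu>))"
      by (simp add: ba)
    moreover have "to_ac b \<noteq> 0"
      using ba by auto
    moreover have "to_ac \<alpha> + \<mu> = 0 \<longleftrightarrow> \<mu> = to_ac \<alpha>"
    proof -
      have "to_ac \<alpha> + \<mu> = 0 \<longleftrightarrow> to_ac \<alpha> + \<mu> = \<mu> + \<mu>"
        by (simp only: char_2_double[OF char])
      then show ?thesis
        by (simp only: add_right_cancel) (rule eq_commute)
    qed
    ultimately show ?thesis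
      by simp
  qed
  \<comment> \<open>valid for every Jordan reduction of \<open>A\<close>: the forward direction of the theorem needs all of them,
    the backward direction just one\<close>
  have blocks: "commutator_solvable n b A \<longleftrightarrow> (\<forall>(m, \<mu>) \<in> set n_as. \<mu> \<in> {0, to_ac \<alpha>} \<or> even m)"
    if nf: "jordan_nf ?A n_as" for n_as
  proof -
    let ?J = "jordan_matrix n_as"
    have sim: "similar_mat ?A ?J"
      using nf by (simp add: jordan_nf_def)
    from similar_matD[OF this] obtain k where k: "?A \<in> carrier_mat k k" "?J \<in> carrier_mat k k"
      by blast
    then have J: "?J \<in> carrier_mat n n"
      using A' by (metis carrier_matD(1))
    then have n: "n = sum_list (map fst n_as)"
      using carrier_matD(1) jordan_matrix_dim(1) by metis
    have "commutator_solvable n b A \<longleftrightarrow> commutator_solvable n (to_ac b) ?A"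
      using commutator_solvable_descent[OF A] commutator_solvable_map[OF A] by blast
    also have "\<dots> \<longleftrightarrow> commutator_solvable n (to_ac b) ?J"
      using commutator_solvable_similar[OF sim A'] commutator_solvable_similar[OF similar_mat_sym[OF sim] J]
      by blast
    also have "\<dots> \<longleftrightarrow> (\<forall>(m, \<mu>) \<in> set n_as. commutator_solvable m (to_ac b) (jordan_block m \<mu>))"
      unfolding n by (rule commutator_solvable_jordan_matrix)
    also have "\<dots> \<longleftrightarrow> (\<forall>(m, \<mu>) \<in> set n_as. \<mu> \<in> {0, to_ac \<alpha>} \<or> even m)"
    proof -
      have "commutator_solvable m (to_ac b) (jordan_block m \<mu>) \<longleftrightarrow> \<mu> \<in> {0, to_ac \<alpha>} \<or> even m" for m \<mu>
        using jordan_block_solvable[OF char] jordan_block_solvable_imp[OF char] exceptional by blast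
      then show ?thesis
        by simp
    qed
    finally show ?thesis .
  qed
  have "composite_mat n \<alpha> (- \<alpha>) A \<longleftrightarrow> commutator_solvable n b A"
    unfolding composite_iff_idempotent_solution[OF assms(1,2) A]
    using idempotent_solution[OF assms(1) A, of b] by (auto simp: commutator_solvable_def b_def)
  also have "\<dots> \<longleftrightarrow> (\<forall>\<mu> :: 'k alg_closure. \<mu> \<notin> {0, to_ac \<alpha>} \<longrightarrow>
       (\<forall>m. has_jordan_block ?A m \<mu> \<longrightarrow> even m))"
  proof
    assume "commutator_solvable n b A"
    then show "\<forall>\<mu> :: 'k alg_closure. \<mu> \<notin> {0, to_ac \<alpha>} \<longrightarrow>
       (\<forall>m. has_jordan_block ?A m \<mu> \<longrightarrow> even m)"
      using blocks unfolding has_jordan_block_def by blast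
  next
    assume even: "\<forall>\<mu> :: 'k alg_closure. \<mu> \<notin> {0, to_ac \<alpha>} \<longrightarrow>
       (\<forall>m. has_jordan_block ?A m \<mu> \<longrightarrow> even m)"
    obtain n_as where nf: "jordan_nf ?A n_as"
      using jordan_nf_exists_alg_closed[OF A'] by blast
    then show "commutator_solvable n b A"
      unfolding blocks[OF nf] using even by (auto simp: has_jordan_block_def)
  qed
  finally show ?thesis .
qed

end
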